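(* A functional $\ell:\mathrm{USC}\to[0,\infty)$ is the tail dependence functional of a max-stable random sup-measure on $E$ (which is then unique in distribution) if and only if (i) $\ell$ is homogeneous: $\ell(cf)=c\,\ell(f)$ for all $c>0$, $f\in\mathrm{USC}$; (ii) $\ell$ is max-completely alternating on $\mathrm{USC}$; and (iii) $\ell$ is upper semicontinuous: $\ell(f_n)\downarrow\ell(f)$ whenever $f_n,f\in\mathrm{USC}$ and $f_n\downarrow f$ pointwise.
   Context: $E$ is a locally compact Hausdorff second countable space; $\mathcal K$, $\mathcal G$ are its compact and open subsets. A sup-measure on $E$ is a map $\varphi$ from subsets of $E$ to $[0,\infty]$, finite on compact sets, which is a Choquet capacity (non-decreasing, $\varphi(\emptyset)=0$, $\varphi(A_n)\uparrow\varphi(A)$ if $A_n\uparrow A$, $\varphi(K_n)\downarrow\varphi(K)$ for compact $K_n\downarrow K$) and satisfies $\varphi(\bigcup_j G_j)=\sup_j\varphi(G_j)$ for every family of open sets. Sup-measures carry the sup-vague topology ($\varphi_n\to\varphi$ iff $\limsup\varphi_n(K)\le\varphi(K)$ for $K\in\mathcal K$ and $\liminf\varphi_n(G)\ge\varphi(G)$ for $G\in\mathcal G$) with its Borel $\sigma$-algebra; a random sup-measure is a random element of this space, its law is determined by the joint laws of $(X(K_1),\dots,X(K_m))$, $K_i\in\mathcal K$. $\mathrm{USC}$ is the family of bounded non-negative upper semicontinuous functions on $E$ with relatively compact support. Extremal integral: $\int^e f\,d\varphi=\sup\{\varphi(K)\inf_{x\in K}f(x):K\in\mathcal K\}$. A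 random variable is unit Fréchet with scale $a\ge0$ if its distribution function is $\exp(-a/t)$, $t>0$. A random sup-measure $X$ is (semi-simple) max-stable if for all $m$, $K_1,\dots,K_m\in\mathcal K$, $u\in[0,\infty)^m$, $\bigvee_i u_iX(K_i)$ is unit Fréchet (equivalently, $\int^e f\,dX$ is unit Fréchet for every $f\in\mathrm{USC}$); the scale parameter of $\int^e f\,dX$ is denoted $\ell(f)$ and $\ell$ is the tail dependence functional of $X$. $\ell$ is max-completely alternating if the differences $\Delta^\vee_{f_1}\ell(f)=\ell(f)-\ell(f\vee f_1)$, $\Delta^\vee_{f_n}\cdots\Delta^\vee_{f_1}\ell(f)=\Delta^\vee_{f_{n-1}}\cdots\Delta^\vee_{f_1}\ell(f)-\Delta^\vee_{f_{n-1}}\cdots\Delta^\vee_{f_1}\ell(f\vee f_n)$ are $\le0$ for all $n\ge1$, $f,f_1,\dots,f_n\in\mathrm{USC}$ ($\vee$ = pointwise maximum). *)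

theory Defs
  imports "HOL-Probability.Probability"
begin

definition choquet_capacity :: "('a::topological_space set \<Rightarrow> ennreal) \<Rightarrow> bool" where
  "choquet_capacity \<phi> \<longleftrightarrow>
     (\<forall>A B. A \<subseteq> B \<longrightarrow> \<phi> A \<le> \<phi> B) \<and>
     \<phi> {} = 0 \<and>
     (\<forall>A :: nat \<Rightarrow> 'a set. incseq A \<longrightarrow> (\<lambda>n. \<phi> (A n)) \<longlonglongrightarrow> \<phi> (\<Union>n. A n)) \<and>
     (\<forall>K :: nat \<Rightarrow> 'a set. (\<forall>n. compact (K n)) \<and> decseq K \<longrightarrow>
         (\<lambda>n. \<phi> (K n)) \<longlonglongrightarrow> \<phi> (\<Inter>n. K n))"

definition sup_measure :: "('a::topological_space set \<Rightarrow> ennreal) \<Rightarrow> bool" where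
  "sup_measure \<phi> \<longleftrightarrow>
     (\<forall>K. compact K \<longrightarrow> \<phi> K < \<infinity>) \<and>
     choquet_capacity \<phi> \<and>
     (\<forall>\<G>. (\<forall>G\<in>\<G>. open G) \<longrightarrow> \<phi> (\<Union>\<G>) = (SUP G\<in>\<G>. \<phi> G))"

definition sup_measures :: "('a::topological_space set \<Rightarrow> ennreal) set" where
  "sup_measures = {\<phi>. sup_measure \<phi>}"

definition sup_vague_topology :: "('a::topological_space set \<Rightarrow> ennreal) topology" where
  "sup_vague_topology =
     subtopology
       (topology_generated_by
          ({{\<phi>. \<phi> K < x} | K x. compact K} \<union> {{\<phi>. x < \<phi> G} | G x. open G}))
       sup_measures"

definition borel_of_top :: "'b topology \<Rightarrow> 'b measure" where
  "borel_of_top T = sigma (topspace T) {U. openin T U}"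

definition random_sup_measure ::
  "'m measure \<Rightarrow> ('m \<Rightarrow> ('a::topological_space set \<Rightarrow> ennreal)) \<Rightarrow> bool" where
  "random_sup_measure M X \<longleftrightarrow> prob_space M \<and> X \<in> M \<rightarrow>\<^sub>M borel_of_top sup_vague_topology"

definition upper_semicont :: "('a::topological_space \<Rightarrow> real) \<Rightarrow> bool" where
  "upper_semicont f \<longleftrightarrow> (\<forall>t. open {x. f x < t})"

definition USC :: "('a::topological_space \<Rightarrow> real) set" where
  "USC = {f. (\<forall>x. 0 \<le> f x) \<and> bounded (range f) \<and> upper_semicont f \<and>
             compact (closure {x. f x \<noteq> 0})}"

definition extremal_integral :: "('a::topological_space set \<Rightarrow> ennreal) \<Rightarrow> ('a \<Rightarrow> real) \<Rightarrow> ennreal" where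
  "extremal_integral \<phi> f = (SUP K\<in>{K. compact K}. \<phi> K * ennreal (INF x\<in>K. f x))"

definition unit_frechet :: "'m measure \<Rightarrow> ('m \<Rightarrow> ennreal) \<Rightarrow> real \<Rightarrow> bool" where
  "unit_frechet M Y a \<longleftrightarrow> 0 \<le> a \<and> Y \<in> borel_measurable M \<and>
     (\<forall>t>0. measure M {\<omega>\<in>space M. Y \<omega> \<le> ennreal t} = exp (- a / t))"

definition max_stable ::
  "'m measure \<Rightarrow> ('m \<Rightarrow> ('a::topological_space set \<Rightarrow> ennreal)) \<Rightarrow> bool" where
  "max_stable M X \<longleftrightarrow> random_sup_measure M X \<and>
     (\<forall>m::nat. \<forall>K :: nat \<Rightarrow> 'a set. \<forall>u :: nat \<Rightarrow> real.
        1 \<le> m \<and> (\<forall>i<m. compact (K i) \<and> 0 \<le> u i) \<longrightarrow>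
        (\<exists>a. unit_frechet M (\<lambda>\<omega>. SUP i\<in>{..<m}. ennreal (u i) * X \<omega> (K i)) a))"

definition tail_dependence_functional ::
  "'m measure \<Rightarrow> ('m \<Rightarrow> ('a::topological_space set \<Rightarrow> ennreal)) \<Rightarrow> (('a \<Rightarrow> real) \<Rightarrow> real) \<Rightarrow> bool" where
  "tail_dependence_functional M X L \<longleftrightarrow> max_stable M X \<and>
     (\<forall>f\<in>USC. unit_frechet M (\<lambda>\<omega>. extremal_integral (X \<omega>) f) (L f))"

text \<open>Iterated max-differences: for the list [f_n, ..., f_1] this gives
  Delta_{f_n} ... Delta_{f_1} ell (f).\<close>

fun max_diff :: "(('a \<Rightarrow> real) \<Rightarrow> real) \<Rightarrow> ('a \<Rightarrow> real) list \<Rightarrow> ('a \<Rightarrow> real) \<Rightarrow> real" where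
  "max_diff L [] f = L f"
| "max_diff L (g # gs) f = max_diff L gs f - max_diff L gs (\<lambda>x. max (f x) (g x))"

definition homogeneous_functional :: "(('a::topological_space \<Rightarrow> real) \<Rightarrow> real) \<Rightarrow> bool" where
  "homogeneous_functional L \<longleftrightarrow> (\<forall>c>0. \<forall>f\<in>USC. L (\<lambda>x. c * f x) = c * L f)"

definition max_completely_alternating :: "(('a::topological_space \<Rightarrow> real) \<Rightarrow> real) \<Rightarrow> bool" where
  "max_completely_alternating L \<longleftrightarrow>
     (\<forall>f fs. f \<in> USC \<and> fs \<noteq> [] \<and> set fs \<subseteq> USC \<longrightarrow> max_diff L fs f \<le> 0)"

definition usc_functional :: "(('a::topological_space \<Rightarrow> real) \<Rightarrow> real) \<Rightarrow> bool" where
  "usc_functional L \<longleftrightarrow>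
     (\<forall>fn :: nat \<Rightarrow> 'a \<Rightarrow> real. \<forall>f.
        (\<forall>n. fn n \<in> USC) \<and> f \<in> USC \<and> (\<forall>x. decseq (\<lambda>n. fn n x)) \<and>
        (\<forall>x. (\<lambda>n. fn n x) \<longlonglongrightarrow> f x) \<longrightarrow>
        decseq (\<lambda>n. L (fn n)) \<and> (\<lambda>n. L (fn n)) \<longlonglongrightarrow> L f)"

end

(* A sup-measure phi is determined by its upper semicontinuous density x -> phi {x}, and the extremal
   integral of f is the supremum of f times the density. Since P(int f dX <= t) = exp (- L f / t), the
   inclusion-exclusion formula for the events {int f dX <= t}, combined with t (1 - exp (- a / t)) -> a,
   gives complete alternation of L, and the same formula determines the finite-dimensional laws.

   Conversely, for finitely many functions f_j the Moebius inverse of B -> L (max over B of f_j) is a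
   nonnegative measure nu on nonempty index sets; the sets of indices that avoid the points of a Poisson
   process with intensity nu have the avoidance probabilities exp (- L (max ...)). Kolmogorov's theorem
   turns this into events "phi (closure U) <= 1 / q", for U in a countable base and q rational. The
   density of X is the infimum of the bounds 1 / q over the open sets U containing x, and upper
   semicontinuity of L shows that passing from closure U to U loses no probability. *)

theory Submission
  imports Defs
begin

section \<open>Sup-measures and their densities\<close>

text \<open>The bounds have the form \<open>1 / q\<close> because
  \<open>\<phi> (closure U) \<le> 1 / q\<close> says that \<open>q * indicator (closure U)\<close>
  has extremal integral at most 1. Imposing several bounds then amounts to taking the maximum of
  these functions, which is what L is evaluated at.

  Two obstacles shape the construction. First, Kolmogorov's theorem yields events that are related
  only up to null sets: at some sample points a weaker bound may fail although a stronger one holds.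
  A countable index family allows all such points to be discarded at once. Second,
  \<open>extremal_integral \<phi> f \<le> 1\<close> is not a condition on finitely many bounds. It
  follows from the existence of a finite covering of f by boxes, while such a covering is obtained
  only from the strict inequality. The covering event has probability exactly
  \<open>exp (- L f)\<close>, and since exp (- a / t) is continuous in t, rescaling f closes the gap
  between \<open><\<close> and \<open>\<le>\<close>. The same gap reappears in the proof that L is
  upper semicontinuous, where a level s < 1 tends to 1.\<close>

lemma relatively_compact_basis:
  assumes "locally_compact_space (euclidean :: 'a::{t2_space,second_countable_topology} topology)"
  obtains \<U> :: "'a::{t2_space,second_countable_topology} set set" where "countable \<U>"
    and "\<And>U. U \<in> \<U> \<Longrightarrow> open U" and "\<And>U. U \<in> \<U> \<Longrightarrow> compact (closure U)"
    and "\<And>U V. U \<in> \<U> \<Longrightarrow> V \<in> \<U> \<Longrightarrow> U \<inter> V \<in> \<U>"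
    and "\<And>x G. open G \<Longrightarrow> x \<in> G \<Longrightarrow> \<exists>U\<in>\<U>. x \<in> U \<and> closure U \<subseteq> G"
proof -
  obtain \<B> :: "'a set set" where \<B>: "countable \<B>" "topological_basis \<B>"
    using ex_countable_basis by blast
  have Haus: "Hausdorff_space (euclidean :: 'a topology)"
    unfolding Hausdorff_space_def disjnt_def using hausdorff by fastforce
  \<comment> \<open>Finite intersections make \<open>\<U>\<close> closed under intersection, which
    later gives two coverings a common refinement (\<open>meet\<close>). Compact closure is imposed
    as a filter; by local compactness, small basis sets around each point pass it.\<close>
  define \<U> where "\<U> = {U \<in> Inter ` {F. finite F \<and> F \<subseteq> \<B>}. compact (closure U)}"
  show thesis
  proof
    have "countable {F. finite F \<and> F \<subseteq> \<B>}"
      using \<B>(1) by (rule countable_Collect_finite_subset)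
    then show "countable \<U>"
      unfolding \<U>_def by (auto intro: countable_subset[OF _ countable_image])
    show "open U" if "U \<in> \<U>" for U
      using that topological_basis_open[OF \<B>(2)] unfolding \<U>_def by (auto intro!: open_Inter)
    show "compact (closure U)" if "U \<in> \<U>" for U
      using that unfolding \<U>_def by auto
    show "U \<inter> V \<in> \<U>" if UV: "U \<in> \<U>" "V \<in> \<U>" for U V
    proof -
      obtain F G where "U = \<Inter>F" "V = \<Inter>G" "finite F" "F \<subseteq> \<B>" "finite G" "G \<subseteq> \<B>"
        using UV unfolding \<U>_def by auto
      then have "U \<inter> V = \<Inter>(F \<union> G)" "finite (F \<union> G)" "F \<union> G \<subseteq> \<B>" by auto
      moreover have "compact (closure (U \<inter> V))"
        using UV compact_Int_closed[of "closure U" "closure (U \<inter> V)"] closure_mono[of "U \<inter> V" U]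
        unfolding \<U>_def by (auto simp: inf.absorb2)
      ultimately show ?thesis unfolding \<U>_def by auto
    qed
    show "\<exists>U\<in>\<U>. x \<in> U \<and> closure U \<subseteq> G" if G: "open G" "x \<in> G" for x G
    proof -
      have "neighbourhood_base_of (\<lambda>C. compactin euclidean C \<and> closedin euclidean C) (euclidean :: 'a topology)"
        using assms locally_compact_space_neighbourhood_base_closedin[OF disjI1[OF Haus]] by blast
      moreover have "openin euclidean G" using G by (simp add: open_openin[symmetric])
      ultimately obtain V C where "openin euclidean V" "compactin euclidean C \<and> closedin euclidean C" "x \<in> V" "V \<subseteq> C" "C \<subseteq> G"
        using G(2) unfolding neighbourhood_base_of by meson
      then have VC: "open V" "compact C" "closed C" "x \<in> V" "V \<subseteq> C" "C \<subseteq> G"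
        by (simp_all add: open_openin[symmetric] closed_closedin[symmetric])
      obtain B where B: "B \<in> \<B>" "x \<in> B" "B \<subseteq> V"
        by (rule topological_basisE[OF \<B>(2) VC(1,4)])
      have cl: "closure B \<subseteq> C" using B VC by (meson closure_minimal subset_trans)
      then have "compact (closure B)"
        using compact_Int_closed[OF VC(2), of "closure B"] by (simp add: inf.absorb2)
      then have "B \<in> \<U>" unfolding \<U>_def using B by (auto intro!: image_eqI[of _ _ "{B}"])
      moreover have "closure B \<subseteq> G" using cl VC by simp
      ultimately show ?thesis using B(2) by blast
    qed
  qed
qed

text \<open>Finitely many of the open sets \<open>{x. d x < s}\<close> with s < t cover K, so the
  largest of these s bounds d. The assumption 0 < t serves the empty set, whose supremum is
  0.\<close>

lemma compact_SUP_less: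
  fixes d :: "'a::topological_space \<Rightarrow> ennreal"
  assumes "\<And>t. open {x. d x < t}" "compact K" "0 < t" "\<And>x. x \<in> K \<Longrightarrow> d x < t"
  shows "(SUP x\<in>K. d x) < t"
proof -
  have "\<exists>s<t. d x < s" if "x \<in> K" for x
    using assms(4)[OF that] dense by blast
  then have "K \<subseteq> (\<Union>s\<in>{..<t}. {x. d x < s})" by auto
  then obtain S where S: "S \<subseteq> {..<t}" "finite S" "K \<subseteq> (\<Union>s\<in>S. {x. d x < s})"
    using compactE_image[OF assms(2), of "{..<t}" "\<lambda>s. {x. d x < s}"] assms(1) by metis
  have "(SUP x\<in>K. d x) \<le> Max (insert 0 S)"
    using S by (force intro!: SUP_least simp: Max_ge_iff less_imp_le)
  also have "\<dots> < t" using S assms(3) by auto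
  finally show ?thesis .
qed

lemma sup_measure_SUP:
  fixes d :: "'a::t2_space \<Rightarrow> ennreal"
  assumes op: "\<And>t. open {x. d x < t}" and fin: "\<And>x. d x < \<infinity>"
  shows "sup_measure (\<lambda>A. SUP x\<in>A. d x)"
  unfolding sup_measure_def choquet_capacity_def
proof (intro conjI allI impI)
  fix K :: "'a set" assume "compact K"
  then show "(SUP x\<in>K. d x) < \<infinity>" using compact_SUP_less[OF op, of K \<infinity>] fin by auto
next
  fix A B :: "'a set" assume "A \<subseteq> B"
  then show "(SUP x\<in>A. d x) \<le> (SUP x\<in>B. d x)" by (rule SUP_subset_mono) simp
next
  show "(SUP x\<in>{}. d x) = 0" by (simp add: bot_ennreal)
next
  fix A :: "nat \<Rightarrow> 'a set" assume "incseq A"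
  then have "incseq (\<lambda>n. SUP x\<in>A n. d x)" by (auto simp: incseq_def intro!: SUP_subset_mono)
  then have "(\<lambda>n. SUP x\<in>A n. d x) \<longlonglongrightarrow> (SUP n. SUP x\<in>A n. d x)" by (rule LIMSEQ_SUP)
  then show "(\<lambda>n. SUP x\<in>A n. d x) \<longlonglongrightarrow> (SUP x\<in>(\<Union>n. A n). d x)" by (simp add: SUP_UNION)
next
  fix K :: "nat \<Rightarrow> 'a set" assume K: "(\<forall>n. compact (K n)) \<and> decseq K"
  then have "decseq (\<lambda>n. SUP x\<in>K n. d x)" by (auto simp: decseq_def intro!: SUP_subset_mono)
  then have lim: "(\<lambda>n. SUP x\<in>K n. d x) \<longlonglongrightarrow> (INF n. SUP x\<in>K n. d x)" by (rule LIMSEQ_INF)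
  have "(INF n. SUP x\<in>K n. d x) \<le> t" if t: "(SUP x\<in>(\<Inter>n. K n). d x) < t" for t
  proof -
    \<comment> \<open>Complements of the \<open>K n\<close> join the sublevel set in an open cover
      of \<open>K 0\<close>: a point of the intersection satisfies d x < t, any other point lies
      outside some \<open>K n\<close>. A finite subcover puts a single \<open>K N\<close> inside the
      sublevel set.\<close>
    have "K 0 \<subseteq> (\<Union>n\<in>UNIV. {x. d x < t} \<union> - K n)"
      using le_less_trans[OF SUP_upper t] by auto
    moreover have "open ({x. d x < t} \<union> - K n)" for n
      using op K by (auto intro!: open_Un simp: compact_imp_closed open_Compl)
    ultimately obtain S where S: "finite S" "K 0 \<subseteq> (\<Union>n\<in>S. {x. d x < t} \<union> - K n)"
      using compactE_image[of "K 0" UNIV "\<lambda>n. {x. d x < t} \<union> - K n"] K by metis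
    define N where "N = Max (insert 0 S)"
    have N: "K N \<subseteq> K n" if "n \<in> insert 0 S" for n
      using that S(1) K unfolding N_def decseq_def by (meson Max_ge finite_insert)
    have "K N \<subseteq> {x. d x < t}" using N S(2) by blast
    then have "(SUP x\<in>K N. d x) \<le> t" by (intro SUP_least) (blast intro: less_imp_le)
    then show ?thesis by (rule INF_lower2[rotated]) simp
  qed
  then have "(INF n. SUP x\<in>K n. d x) \<le> (SUP x\<in>(\<Inter>n. K n). d x)" by (rule dense_ge)
  moreover have "(SUP x\<in>(\<Inter>n. K n). d x) \<le> (INF n. SUP x\<in>K n. d x)"
    by (intro INF_greatest SUP_subset_mono) auto
  ultimately show "(\<lambda>n. SUP x\<in>K n. d x) \<longlonglongrightarrow> (SUP x\<in>(\<Inter>n. K n). d x)"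
    using lim by (metis order_antisym)
next
  fix \<G> :: "'a set set"
  show "(SUP x\<in>\<Union>\<G>. d x) = (SUP G\<in>\<G>. SUP x\<in>G. d x)" 
    by (rule antisym; intro SUP_least) (auto intro: SUP_upper2)
qed

lemma sup_measure_mono: "sup_measure \<phi> \<Longrightarrow> A \<subseteq> B \<Longrightarrow> \<phi> A \<le> \<phi> B"
  by (auto simp: sup_measure_def choquet_capacity_def)

lemma sup_measure_empty: "sup_measure \<phi> \<Longrightarrow> \<phi> {} = 0"
  by (auto simp: sup_measure_def choquet_capacity_def)

context
  fixes \<phi> :: "'a::{t2_space,second_countable_topology} set \<Rightarrow> ennreal"
  assumes lc: "locally_compact_space (euclidean :: 'a topology)" and \<phi>: "sup_measure \<phi>"
begin

text \<open>The closures of the \<open>B n\<close> are compact and shrink to {x}, so continuity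
  along decreasing compact sets carries a bound at x to a neighbourhood. This yields upper
  semicontinuity of the density.\<close>

lemma sup_measure_neighbourhood:
  assumes "\<phi> {x} < t"
  shows "\<exists>G. open G \<and> x \<in> G \<and> \<phi> G < t"
proof -
  obtain \<U> :: "'a set set" where \<U>: "\<And>U. U \<in> \<U> \<Longrightarrow> open U" "\<And>U. U \<in> \<U> \<Longrightarrow> compact (closure U)"
    "\<And>x G. open G \<Longrightarrow> x \<in> G \<Longrightarrow> \<exists>U\<in>\<U>. x \<in> U \<and> closure U \<subseteq> G"
    using relatively_compact_basis[OF lc] by metis
  obtain A where A: "\<And>i. open (A i)" "\<And>i. x \<in> A i"
    "\<And>S. open S \<Longrightarrow> x \<in> S \<Longrightarrow> eventually (\<lambda>i. A i \<subseteq> S) sequentially"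
    by (rule countable_basis_at_decseq[of x]) metis
  obtain U0 where U0: "U0 \<in> \<U>" "x \<in> U0" using \<U>(3)[of UNIV x] by auto
  define B where "B n = U0 \<inter> (\<Inter>i\<le>n. A i)" for n
  have B: "open (B n)" "x \<in> B n" "decseq B" for n
    unfolding B_def decseq_def using U0 \<U>(1) A by (auto intro!: open_Int open_INT)
  have cp: "compact (closure (B n))" for n
    using compact_Int_closed[OF \<U>(2)[OF U0(1)] closed_closure, of "B n"] closure_mono[of "B n" U0]
    by (simp add: B_def inf.absorb2)
  have "decseq (\<lambda>n. closure (B n))" using B(3) by (auto simp: decseq_def closure_mono)
  then have lim: "(\<lambda>n. \<phi> (closure (B n))) \<longlonglongrightarrow> \<phi> (\<Inter>n. closure (B n))"
    using \<phi> cp by (auto simp: sup_measure_def choquet_capacity_def)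
  have "(\<Inter>n. closure (B n)) = {x}"
  proof (intro subset_antisym subsetI)
    fix y assume y: "y \<in> (\<Inter>n. closure (B n))"
    show "y \<in> {x}"
    proof (rule ccontr)
      assume "y \<notin> {x}"
      then obtain V W where VW: "open V" "open W" "x \<in> V" "y \<in> W" "V \<inter> W = {}"
        using hausdorff[of x y] by auto
      obtain n where "A n \<subseteq> V" using A(3)[OF VW(1,3)] by (auto simp: eventually_sequentially)
      then have "B n \<subseteq> - W" using VW unfolding B_def by auto
      then have "closure (B n) \<subseteq> - W" using VW by (intro closure_minimal) auto
      then show False using y VW by auto
    qed
  qed (use B closure_subset in fastforce)
  then have "eventually (\<lambda>n. \<phi> (closure (B n)) < t) sequentially"
    using order_tendstoD(2)[OF lim] assms by simp
  then obtain n where "\<phi> (closure (B n)) < t" by (auto simp: eventually_sequentially)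
  then have "\<phi> (B n) < t" using sup_measure_mono[OF \<phi> closure_subset] by (rule le_less_trans[rotated])
  then show ?thesis using B by blast
qed

lemma sup_measure_eq_SUP: "\<phi> A = (SUP x\<in>A. \<phi> {x})"
proof (rule antisym)
  show "(SUP x\<in>A. \<phi> {x}) \<le> \<phi> A" by (auto intro!: SUP_least sup_measure_mono[OF \<phi>])
  show "\<phi> A \<le> (SUP x\<in>A. \<phi> {x})"
  proof (rule dense_ge)
    fix t assume t: "(SUP x\<in>A. \<phi> {x}) < t"
    have "\<exists>G. open G \<and> x \<in> G \<and> \<phi> G < t" if "x \<in> A" for x
      using sup_measure_neighbourhood[OF le_less_trans[OF SUP_upper t]] that by blast
    \<comment> \<open>The union axiom concerns open sets, yet it controls an arbitrary A: A is
      enclosed in a union of open sets on each of which \<open>\<phi>\<close> stays below t.\<close>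
    then obtain G where G: "\<And>x. x \<in> A \<Longrightarrow> open (G x) \<and> x \<in> G x \<and> \<phi> (G x) < t" by metis
    have "\<phi> A \<le> \<phi> (\<Union>(G ` A))" using G by (intro sup_measure_mono[OF \<phi>]) auto
    also have "\<dots> = (SUP B\<in>G ` A. \<phi> B)" using \<phi> G by (auto simp: sup_measure_def)
    also have "\<dots> \<le> t" using G by (intro SUP_least) (auto simp: less_imp_le)
    finally show "\<phi> A \<le> t" .
  qed
qed

lemma open_sup_measure_less: "open {x. \<phi> {x} < t}"
proof (subst open_subopen, clarify)
  fix x assume "\<phi> {x} < t"
  then obtain G where G: "open G" "x \<in> G" "\<phi> G < t" using sup_measure_neighbourhood by blast
  have "G \<subseteq> {x. \<phi> {x} < t}" using G sup_measure_mono[OF \<phi>, of "{_}" G] by (auto intro: le_less_trans)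
  then show "\<exists>T. open T \<and> x \<in> T \<and> T \<subseteq> {x. \<phi> {x} < t}" using G by blast
qed

lemma extremal_integral_eq_SUP:
  assumes "\<And>x. 0 \<le> f x"
  shows "extremal_integral \<phi> f = (SUP x. \<phi> {x} * ennreal (f x))"
  unfolding extremal_integral_def
proof (intro antisym SUP_least)
  fix K :: "'a set" assume "K \<in> {K. compact K}"
  show "\<phi> K * ennreal (INF x\<in>K. f x) \<le> (SUP x. \<phi> {x} * ennreal (f x))"
  \<comment> \<open>For empty K the real infimum carries no information; the product vanishes
    because \<open>\<phi> {} = 0\<close>.\<close>
  proof (cases "K = {}")
    case False
    have "\<phi> K * ennreal (INF x\<in>K. f x) = (SUP x\<in>K. \<phi> {x} * ennreal (INF x\<in>K. f x))"
      by (subst sup_measure_eq_SUP) (simp add: SUP_mult_right_ennreal)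
    also have "\<dots> \<le> (SUP x. \<phi> {x} * ennreal (f x))"
      using assms by (intro SUP_mono) (auto intro!: exI mult_left_mono ennreal_leI cINF_lower bdd_belowI2[of _ 0])
    finally show ?thesis .
  qed (simp add: sup_measure_empty[OF \<phi>])
next
  fix x :: 'a
  show "\<phi> {x} * ennreal (f x) \<le> (SUP K\<in>{K. compact K}. \<phi> K * ennreal (INF x\<in>K. f x))"
    by (rule SUP_upper2[of "{x}"]) auto
qed

end

section \<open>The Borel sets of the sup-vague topology\<close>

text \<open>Second countability in disguise: on \<open>\<Omega>\<close>, finite intersections of
  members of \<open>\<N>\<close> behave like a countable base, so every open set is a countable
  union of measurable sets even when the subbasis \<open>\<S>\<close> is uncountable.\<close>

lemma generate_topology_on_sigma:
  assumes sa: "sigma_algebra \<Omega> \<Sigma>" and cnt: "countable \<N>" and meas: "\<And>N. N \<in> \<N> \<Longrightarrow> N \<inter> \<Omega> \<in> \<Sigma>"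
    and sub: "\<And>S p. S \<in> \<S> \<Longrightarrow> p \<in> S \<inter> \<Omega> \<Longrightarrow> \<exists>N\<in>\<N>. p \<in> N \<and> N \<inter> \<Omega> \<subseteq> S"
    and U: "generate_topology_on \<S> U"
  shows "U \<inter> \<Omega> \<in> \<Sigma>"
proof -
  interpret sigma_algebra \<Omega> \<Sigma> by fact
  have *: "\<exists>F. finite F \<and> F \<subseteq> \<N> \<and> p \<in> \<Inter>F \<and> \<Inter>F \<inter> \<Omega> \<subseteq> U" if "p \<in> U \<inter> \<Omega>" for p
    using U that
  proof (induction arbitrary: p)
    case (Int a b)
    obtain F G where "finite F" "F \<subseteq> \<N>" "p \<in> \<Inter>F" "\<Inter>F \<inter> \<Omega> \<subseteq> a" "finite G" "G \<subseteq> \<N>" "p \<in> \<Inter>G" "\<Inter>G \<inter> \<Omega> \<subseteq> b"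
      using Int.IH(1)[of p] Int.IH(2)[of p] Int.prems by auto
    then show ?case by (intro exI[of _ "F \<union> G"]) auto
  next
    case (UN K)
    then show ?case by fast
  next
    case (Basis s)
    then obtain N where "N \<in> \<N>" "p \<in> N" "N \<inter> \<Omega> \<subseteq> s" using sub by blast
    then show ?case by (intro exI[of _ "{N}"]) auto
  qed simp
  define \<F> where "\<F> = {F. finite F \<and> F \<subseteq> \<N> \<and> \<Inter>F \<inter> \<Omega> \<subseteq> U}"
  have "countable \<F>"
    using countable_Collect_finite_subset[OF cnt] unfolding \<F>_def by (rule countable_subset[rotated]) auto
  moreover have "\<Inter>F \<inter> \<Omega> \<in> \<Sigma>" if "F \<in> \<F>" for F
  proof -
    have "finite F" "F \<subseteq> \<N>" using that by (auto simp: \<F>_def)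
    then show ?thesis
    proof (induction F)
      case (insert N F)
      have "\<Inter>(insert N F) \<inter> \<Omega> = (N \<inter> \<Omega>) \<inter> (\<Inter>F \<inter> \<Omega>)" by auto
      then show ?case using insert meas by auto
    qed simp
  qed
  ultimately have "(\<Union>F\<in>\<F>. \<Inter>F \<inter> \<Omega>) \<in> \<Sigma>" by (intro countable_UN'') auto
  moreover have "(\<Union>F\<in>\<F>. \<Inter>F \<inter> \<Omega>) = U \<inter> \<Omega>"
    using * unfolding \<F>_def by fastforce
  ultimately show ?thesis by simp
qed

text \<open>Lower orthants, that is, the events behind the finite-dimensional distribution functions
  at positive levels. They are closed under intersection and generate the Borel sets, so a law is
  determined by its values on them.\<close>

definition compact_cylinder :: "('a::topological_space set \<times> real) set \<Rightarrow> ('a set \<Rightarrow> ennreal) set" where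
  "compact_cylinder B = {\<phi>\<in>sup_measures. \<forall>(K, t)\<in>B. \<phi> K \<le> ennreal t}"

definition compact_cylinders :: "('a::topological_space set \<Rightarrow> ennreal) set set" where
  "compact_cylinders = compact_cylinder ` {B. finite B \<and> (\<forall>(K, t)\<in>B. compact K \<and> 0 < t)}"

lemma Int_stable_compact_cylinders: "Int_stable compact_cylinders"
proof (rule Int_stableI)
  fix a b :: "('a set \<Rightarrow> ennreal) set" assume "a \<in> compact_cylinders" "b \<in> compact_cylinders"
  then obtain B C where "a = compact_cylinder B" "finite B" "\<forall>(K, t)\<in>B. compact K \<and> 0 < t"
    "b = compact_cylinder C" "finite C" "\<forall>(K, t)\<in>C. compact K \<and> 0 < t"
    unfolding compact_cylinders_def by auto
  then show "a \<inter> b \<in> compact_cylinders"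
    unfolding compact_cylinders_def by (intro image_eqI[of _ _ "B \<union> C"]) (auto simp: compact_cylinder_def)
qed

lemma compact_cylinders_subset: "compact_cylinders \<subseteq> Pow sup_measures"
  by (auto simp: compact_cylinders_def compact_cylinder_def)

lemma topspace_sup_vague: "topspace sup_vague_topology = sup_measures"
proof -
  have "\<phi> \<in> {\<phi>. \<phi> {} < 1}" if "\<phi> \<in> sup_measures" for \<phi> :: "'a set \<Rightarrow> ennreal"
    using that by (simp add: sup_measures_def sup_measure_empty)
  then have "sup_measures \<subseteq> \<Union>({{\<phi> :: 'a set \<Rightarrow> ennreal. \<phi> K < x} | K x. compact K} \<union> {{\<phi>. x < \<phi> G} | G x. open G})"
    using compact_empty by blast
  then show ?thesis unfolding sup_vague_topology_def by auto
qed

lemma sets_borel_of_top: "sets (borel_of_top T) = sigma_sets (topspace T) {U. openin T U}"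
  and space_borel_of_top: "space (borel_of_top T) = topspace T"
  using openin_subset[of T] by (simp_all add: borel_of_top_def subset_iff)

lemmas sets_borel_sup_vague_eq = sets_borel_of_top[of sup_vague_topology, unfolded topspace_sup_vague]
lemmas space_borel_sup_vague = space_borel_of_top[of sup_vague_topology, unfolded topspace_sup_vague]

lemma measurable_compact_eval:
  assumes "compact K"
  shows "(\<lambda>\<phi>. \<phi> K) \<in> borel_of_top sup_vague_topology \<rightarrow>\<^sub>M borel"
proof (rule borel_measurableI_less)
  fix x
  have "openin sup_vague_topology ({\<phi>. \<phi> K < x} \<inter> sup_measures)"
    unfolding sup_vague_topology_def using assms
    by (intro openin_subtopology_Int topology_generated_by_Basis) auto
  then show "{\<phi> \<in> space (borel_of_top sup_vague_topology). \<phi> K < x} \<in> sets (borel_of_top sup_vague_topology)"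
    unfolding space_borel_sup_vague sets_borel_sup_vague_eq
    by (intro sigma_sets.Basic) (simp add: Int_def conj_commute)
qed

lemma ennreal_rat_dense:
  fixes x y :: ennreal
  assumes "x < y"
  shows "\<exists>q::rat. 0 < q \<and> x < ennreal (of_rat q) \<and> ennreal (of_rat q) < y"
proof -
  obtain r where r: "x < ennreal r" "ennreal r < y" "0 \<le> r"
  proof -
    obtain z where "x < z" "z < y" using dense[OF assms] by blast
    then show thesis using that by (cases z) auto
  qed
  obtain s where s: "r < s" "ennreal s < y"
  proof (cases y)
    case (real y')
    then obtain s where "r < s" "s < y'" using dense[of r y'] r by (auto simp: ennreal_less_iff)
    then show thesis using that real r by (auto simp: ennreal_less_iff)
  qed (use that[of "r + 1"] in auto)
  obtain q where q: "r < of_rat q" "of_rat q < s" using of_rat_dense[OF s(1)] by blast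
  then have "x < ennreal (of_rat q)" "ennreal (of_rat q) < y"
    using r s by (auto intro: less_le_trans le_less_trans ennreal_leI less_imp_le)
  moreover have "(0::real) < of_rat q" using q r by linarith
  ultimately show ?thesis by (auto simp: zero_less_of_rat_iff)
qed

context
  assumes lc: "locally_compact_space (euclidean :: 'a::{t2_space,second_countable_topology} topology)"
begin

lemma compact_eval_less_in_sigma:
  fixes K :: "'a set"
  assumes "compact K"
  shows "{\<phi>. \<phi> K < x} \<inter> sup_measures \<in> sigma_sets sup_measures compact_cylinders"
proof -
  interpret sigma_algebra sup_measures "sigma_sets sup_measures (compact_cylinders :: ('a set \<Rightarrow> ennreal) set set)"
    by (rule sigma_algebra_sigma_sets[OF compact_cylinders_subset])
  have "compact_cylinder {(K, t)} \<in> sigma_sets sup_measures compact_cylinders" if "0 < t" for t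
    using that assms by (intro sigma_sets.Basic) (auto simp: compact_cylinders_def)
  then have "(\<Union>q\<in>{q::rat. 0 < q \<and> ennreal (of_rat q) < x}. compact_cylinder {(K, of_rat q)}) \<in> sigma_sets sup_measures compact_cylinders"
    by (intro countable_UN'') auto
  also have "(\<Union>q\<in>{q::rat. 0 < q \<and> ennreal (of_rat q) < x}. compact_cylinder {(K, of_rat q)}) = {\<phi>. \<phi> K < x} \<inter> sup_measures"
    unfolding compact_cylinder_def using ennreal_rat_dense by (fastforce intro: le_less_trans less_imp_le)
  finally show ?thesis .
qed

text \<open>The subbasis ranges over all compact sets, open sets and levels. A countable family
  replaces it: finite unions of closures of base sets with rational upper levels, and base sets with
  rational lower levels.\<close>

lemma sup_vague_openin_sigma:
  assumes "openin (sup_vague_topology :: ('a set \<Rightarrow> ennreal) topology) U"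
  shows "U \<in> sigma_sets sup_measures compact_cylinders"
proof -
  interpret sigma_algebra sup_measures "sigma_sets sup_measures (compact_cylinders :: ('a set \<Rightarrow> ennreal) set set)"
    by (rule sigma_algebra_sigma_sets[OF compact_cylinders_subset])
  obtain \<U> :: "'a set set" where \<U>: "countable \<U>" "\<And>U. U \<in> \<U> \<Longrightarrow> open U" "\<And>U. U \<in> \<U> \<Longrightarrow> compact (closure U)"
    "\<And>x G. open G \<Longrightarrow> x \<in> G \<Longrightarrow> \<exists>U\<in>\<U>. x \<in> U \<and> closure U \<subseteq> G"
    using relatively_compact_basis[OF lc] by metis
  define below where "below = (\<lambda>(F, q). {\<phi> :: 'a set \<Rightarrow> ennreal. \<phi> (\<Union>(closure ` F)) < ennreal (of_rat q)})"
  define above where "above = (\<lambda>(V, q). {\<phi> :: 'a set \<Rightarrow> ennreal. ennreal (of_rat q) < \<phi> V})"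
  define \<N> where "\<N> = below ` ({F. finite F \<and> F \<subseteq> \<U>} \<times> (UNIV :: rat set)) \<union> above ` (\<U> \<times> (UNIV :: rat set))"
  have "countable \<N>"
    unfolding \<N>_def
      by (intro countable_Un countable_image countable_SIGMA countable_Collect_finite_subset \<U>(1)) auto
  have "N \<inter> sup_measures \<in> sigma_sets sup_measures compact_cylinders" if "N \<in> \<N>" for N
    using that unfolding \<N>_def
  proof
    assume "N \<in> below ` ({F. finite F \<and> F \<subseteq> \<U>} \<times> UNIV)"
    then show ?thesis
      unfolding below_def using \<U>(3) by (auto intro!: compact_eval_less_in_sigma compact_UN)
  next
    assume "N \<in> above ` (\<U> \<times> UNIV)"
    then obtain V and q :: rat where V: "V \<in> \<U>" and N: "N = {\<phi>. ennreal (of_rat q) < \<phi> V}"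
      by (auto simp: above_def)
    define \<V> where "\<V> = {W\<in>\<U>. closure W \<subseteq> V}"
    \<comment> \<open>Cylinders only bound values on compact sets from above, so the open condition
      on V is rewritten: it holds iff some \<open>closure W\<close> inside V has value at least r
      for a rational level r above that of q. From left to right, a single point of V with large
      density is enclosed in W.\<close>
    have "N \<inter> sup_measures = (\<Union>W\<in>\<V>. \<Union>r\<in>{r. ennreal (of_rat q) < ennreal (of_rat r)}. sup_measures - ({\<phi>. \<phi> (closure W) < ennreal (of_rat r)} \<inter> sup_measures))"
      (is "_ = ?R")
    proof (intro subset_antisym subsetI)
      fix \<phi> assume \<phi>: "\<phi> \<in> N \<inter> sup_measures"
      then have sm: "sup_measure \<phi>" by (simp add: sup_measures_def)
      have "ennreal (of_rat q) < (SUP x\<in>V. \<phi> {x})"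
        using \<phi> by (subst sup_measure_eq_SUP[OF lc sm, symmetric]) (simp add: N)
      then obtain x where x: "x \<in> V" "ennreal (of_rat q) < \<phi> {x}" by (auto simp: less_SUP_iff)
      then obtain r :: rat where r: "ennreal (of_rat q) < ennreal (of_rat r)" "ennreal (of_rat r) < \<phi> {x}"
        using ennreal_rat_dense by blast
      obtain W where W: "W \<in> \<U>" "x \<in> W" "closure W \<subseteq> V" using \<U>(2,4) V x by blast
      have "\<phi> {x} \<le> \<phi> (closure W)" using W closure_subset by (intro sup_measure_mono[OF sm]) auto
      then have "\<not> \<phi> (closure W) < ennreal (of_rat r)" using r by auto
      then show "\<phi> \<in> ?R" using W r \<phi> by (auto simp: \<V>_def)
    next
      fix \<phi> assume "\<phi> \<in> ?R"
      then obtain W where W: "W \<in> \<V>"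
        and "\<phi> \<in> (\<Union>r\<in>{r. ennreal (of_rat q) < ennreal (of_rat r)}. sup_measures - ({\<phi>. \<phi> (closure W) < ennreal (of_rat r)} \<inter> sup_measures))"
        by (rule UN_E)
      from this(2) obtain r where r: "r \<in> {r. ennreal (of_rat q) < ennreal (of_rat r)}"
        and \<phi>: "\<phi> \<in> sup_measures - ({\<phi>. \<phi> (closure W) < ennreal (of_rat r)} \<inter> sup_measures)"
        by (rule UN_E)
      then have sm: "\<phi> \<in> sup_measures" by simp
      then have le1: "ennreal (of_rat r) \<le> \<phi> (closure W)" using \<phi> by (simp add: not_less)
      have le2: "\<phi> (closure W) \<le> \<phi> V"
        using sm W by (intro sup_measure_mono) (simp_all add: sup_measures_def \<V>_def)
      have "ennreal (of_rat q) < \<phi> V"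
        by (rule less_le_trans[OF CollectD[OF r] order_trans[OF le1 le2]])
      then show "\<phi> \<in> N \<inter> sup_measures" using sm by (simp add: N)
    qed
    also have "\<dots> \<in> sigma_sets sup_measures compact_cylinders"
      using \<U>(3) \<U>(1) by (intro countable_UN'' Diff top compact_eval_less_in_sigma) (auto simp: \<V>_def)
    finally show ?thesis .
  qed
  moreover have "\<exists>N\<in>\<N>. \<phi> \<in> N \<and> N \<inter> sup_measures \<subseteq> S"
    if S: "S \<in> {{\<phi>. \<phi> K < x} | K x. compact K} \<union> {{\<phi>. x < \<phi> G} | G x. open G}" and \<phi>: "\<phi> \<in> S \<inter> sup_measures" for S \<phi>
    using S
  proof
    assume "S \<in> {{\<phi>. \<phi> K < x} | K x. compact K}"
    then obtain K x where K: "compact K" "S = {\<phi>. \<phi> K < x}" by auto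
    have sm: "sup_measure \<phi>" using \<phi> by (simp add: sup_measures_def)
    have "\<phi> K < x" using \<phi> K by auto
    then obtain q :: rat where q: "0 < q" "\<phi> K < ennreal (of_rat q)" "ennreal (of_rat q) < x"
      using ennreal_rat_dense by blast
    have op: "open (\<Union>{V\<in>\<U>. closure V \<subseteq> {y. \<phi> {y} < ennreal (of_rat q)}})" using \<U>(2) by auto
    \<comment> \<open>Base sets whose closures stay where the density is below q still cover K.
      Finitely many of these closures form a compact set around K, on which the supremum remains
      strictly below q.\<close>
    have "K \<subseteq> \<Union>{V\<in>\<U>. closure V \<subseteq> {y. \<phi> {y} < ennreal (of_rat q)}}"
    proof
      fix y assume "y \<in> K"
      then have "\<phi> {y} \<le> \<phi> K" by (intro sup_measure_mono[OF sm]) auto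
      then have "y \<in> {y. \<phi> {y} < ennreal (of_rat q)}" using q by auto
      then show "y \<in> \<Union>{V\<in>\<U>. closure V \<subseteq> {y. \<phi> {y} < ennreal (of_rat q)}}"
        using \<U>(4)[OF open_sup_measure_less[OF lc sm]] by blast
    qed
    then obtain F where F: "F \<subseteq> {V\<in>\<U>. closure V \<subseteq> {y. \<phi> {y} < ennreal (of_rat q)}}" "finite F" "K \<subseteq> \<Union>F"
      using compactE[OF K(1), of "{V\<in>\<U>. closure V \<subseteq> {y. \<phi> {y} < ennreal (of_rat q)}}"] \<U>(2) by auto
    have "compact (\<Union>(closure ` F))" using F \<U>(3) by (auto intro!: compact_UN)
    then have "(SUP y\<in>\<Union>(closure ` F). \<phi> {y}) < ennreal (of_rat q)"
      using F q by (intro compact_SUP_less open_sup_measure_less[OF lc sm]) (auto simp: zero_less_of_rat_iff)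
    then have "\<phi> \<in> below (F, q)" unfolding below_def by (subst (asm) sup_measure_eq_SUP[OF lc sm, symmetric]) simp
    moreover have "below (F, q) \<in> \<N>" using F unfolding \<N>_def by auto
    moreover have "below (F, q) \<inter> sup_measures \<subseteq> S"
    proof
      fix \<psi> assume \<psi>: "\<psi> \<in> below (F, q) \<inter> sup_measures"
      have "K \<subseteq> \<Union>(closure ` F)" by (rule order_trans[OF F(3)]) (auto intro: subsetD[OF closure_subset])
      then have "\<psi> K \<le> \<psi> (\<Union>(closure ` F))" using \<psi> by (intro sup_measure_mono) (simp_all add: sup_measures_def)
      then show "\<psi> \<in> S" using \<psi> q unfolding K below_def by auto
    qed
    ultimately show ?thesis by blast
  next
    assume "S \<in> {{\<phi>. x < \<phi> G} | G x. open G}"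
    then obtain G x where G: "open G" "S = {\<phi>. x < \<phi> G}" by auto
    have sm: "sup_measure \<phi>" using \<phi> by (simp add: sup_measures_def)
    have "x < (SUP y\<in>G. \<phi> {y})" 
      using \<phi> by (subst sup_measure_eq_SUP[OF lc sm, symmetric]) (simp add: G)
    then obtain y where y: "y \<in> G" "x < \<phi> {y}" by (auto simp: less_SUP_iff)
    then obtain q :: rat where q: "x < ennreal (of_rat q)" "ennreal (of_rat q) < \<phi> {y}"
      using ennreal_rat_dense by blast
    obtain V where V: "V \<in> \<U>" "y \<in> V" "closure V \<subseteq> G" using \<U>(4) G y by blast
    have "above (V, q) \<in> \<N>" using V unfolding \<N>_def by auto
    moreover have "\<phi> \<in> above (V, q)"
      using q sup_measure_mono[OF sm, of "{y}" V] V by (auto simp: above_def)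
    moreover have "above (V, q) \<inter> sup_measures \<subseteq> S"
    proof
      fix \<psi> assume \<psi>: "\<psi> \<in> above (V, q) \<inter> sup_measures"
      have "V \<subseteq> G" by (rule order_trans[OF closure_subset V(3)])
      then have "\<psi> V \<le> \<psi> G" using \<psi> by (intro sup_measure_mono) (simp_all add: sup_measures_def)
      then show "\<psi> \<in> S" using \<psi> q unfolding G above_def by auto
    qed
    ultimately show ?thesis by blast
  qed
  moreover obtain V where V: "generate_topology_on ({{\<phi>. \<phi> K < x} | K x. compact K} \<union> {{\<phi>. x < \<phi> G} | G x. open G}) V" "U = V \<inter> sup_measures"
    using assms unfolding sup_vague_topology_def openin_subtopology openin_topology_generated_by_iff by auto
  ultimately show ?thesis
    using generate_topology_on_sigma[OF sigma_algebra_axioms \<open>countable \<N>\<close> _ _ V(1)] by blast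
qed

lemma sets_borel_sup_vague:
  "sets (borel_of_top sup_vague_topology) = sigma_sets sup_measures (compact_cylinders :: ('a set \<Rightarrow> ennreal) set set)"
proof
  show "sets (borel_of_top sup_vague_topology) \<subseteq> sigma_sets sup_measures (compact_cylinders :: ('a set \<Rightarrow> ennreal) set set)"
    unfolding sets_borel_sup_vague_eq using sup_vague_openin_sigma
    by (intro sigma_algebra.sigma_sets_subset sigma_algebra_sigma_sets compact_cylinders_subset) auto
  have "compact_cylinder B \<in> sets (borel_of_top sup_vague_topology)"
    if "finite B" "\<forall>(K, t)\<in>B. compact K \<and> 0 < t" for B :: "('a set \<times> real) set"
  proof -
    have "{\<phi>\<in>space (borel_of_top sup_vague_topology). \<forall>b\<in>B. \<phi> (fst b) \<le> ennreal (snd b)} \<in> sets (borel_of_top sup_vague_topology)"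
      using that by (intro sets.sets_Collect_finite_All borel_measurable_le borel_measurable_const measurable_compact_eval) auto
    then show ?thesis
      by (simp add: compact_cylinder_def space_borel_sup_vague case_prod_beta)
  qed
  then have "compact_cylinders \<subseteq> sets (borel_of_top (sup_vague_topology :: ('a set \<Rightarrow> ennreal) topology))"
    by (auto simp: compact_cylinders_def)
  then show "sigma_sets sup_measures (compact_cylinders :: ('a set \<Rightarrow> ennreal) set set) \<subseteq> sets (borel_of_top sup_vague_topology)"
    by (metis sets.sigma_sets_subset space_borel_sup_vague)
qed

lemma measurable_sup_vagueI:
  fixes X :: "'m \<Rightarrow> 'a set \<Rightarrow> ennreal"
  assumes "\<And>\<omega>. \<omega> \<in> space M \<Longrightarrow> sup_measure (X \<omega>)" and "\<And>K. compact K \<Longrightarrow> (\<lambda>\<omega>. X \<omega> K) \<in> borel_measurable M"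
  shows "X \<in> M \<rightarrow>\<^sub>M borel_of_top sup_vague_topology"
proof -
  have "X \<in> M \<rightarrow>\<^sub>M sigma sup_measures (compact_cylinders :: ('a set \<Rightarrow> ennreal) set set)"
  proof (rule measurable_measure_of[OF compact_cylinders_subset])
    show "X \<in> space M \<rightarrow> sup_measures" using assms(1) by (auto simp: sup_measures_def)
    fix Y :: "('a set \<Rightarrow> ennreal) set" assume "Y \<in> compact_cylinders"
    then obtain B where B: "Y = compact_cylinder B" "finite B" "\<forall>(K, t)\<in>B. compact K \<and> 0 < t"
      by (auto simp: compact_cylinders_def)
    have "{\<omega>\<in>space M. \<forall>b\<in>B. X \<omega> (fst b) \<le> ennreal (snd b)} \<in> sets M"
      using B by (intro sets.sets_Collect_finite_All borel_measurable_le borel_measurable_const assms(2)) auto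
    also have "{\<omega>\<in>space M. \<forall>b\<in>B. X \<omega> (fst b) \<le> ennreal (snd b)} = X -` Y \<inter> space M"
      using assms(1) by (auto simp: B compact_cylinder_def case_prod_beta sup_measures_def)
    finally show "X -` Y \<inter> space M \<in> sets M" .
  qed
  then show ?thesis
    by (subst measurable_cong_sets[OF refl, of _ "sigma sup_measures (compact_cylinders :: ('a set \<Rightarrow> ennreal) set set)"])
       (auto simp: sets_borel_sup_vague compact_cylinders_subset)
qed

end

section \<open>Events with prescribed avoidance probabilities\<close>

text \<open>Iterated difference of F at B along C, in inclusion-exclusion form;
  \<open>union_diff_insert\<close> is the recursion by which \<open>max_diff\<close> is defined. If
  F B is the probability that all of B survive and C lies in J, then
  \<open>union_diff F C (J - C)\<close> is the probability that exactly \<open>J - C\<close>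
  survives.\<close>

definition union_diff :: "('i set \<Rightarrow> real) \<Rightarrow> 'i set \<Rightarrow> 'i set \<Rightarrow> real" where
  "union_diff F C B = (\<Sum>D\<in>Pow C. (-1) ^ card D * F (B \<union> D))"

lemma sum_Pow_insert:
  fixes f :: "'i set \<Rightarrow> real"
  assumes "finite C" "c \<notin> C"
  shows "(\<Sum>D\<in>Pow (insert c C). f D) = (\<Sum>D\<in>Pow C. f D) + (\<Sum>D\<in>Pow C. f (insert c D))"
proof -
  have "inj_on (insert c) (Pow C)" using assms by (auto simp: inj_on_def)
  moreover have "Pow C \<inter> insert c ` Pow C = {}" using assms by auto
  ultimately show ?thesis using assms by (simp add: Pow_insert sum.union_disjoint sum.reindex)
qed

lemma union_diff_empty: "union_diff F {} B = F B"
  by (simp add: union_diff_def)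

lemma union_diff_insert:
  assumes "finite C" "c \<notin> C"
  shows "union_diff F (insert c C) B = union_diff F C B - union_diff F C (insert c B)"
proof -
  have "card (insert c D) = Suc (card D)" if "D \<in> Pow C" for D
    using that assms finite_subset by (auto intro!: card_insert_disjoint)
  then show ?thesis
    unfolding union_diff_def sum_Pow_insert[OF assms] by (simp add: sum_negf)
qed

text \<open>Moebius inversion. For a new element j, the sets C without j contribute terms based at
  \<open>insert j B\<close>, and these cancel against the subtracted terms of the sets that contain
  j. This is why B stays arbitrary in the induction.\<close>

lemma sum_union_diff:
  assumes "finite J"
  shows "(\<Sum>C\<in>Pow J. union_diff F C (B \<union> (J - C))) = F B"
  using assms
proof (induction J arbitrary: B)
  case (insert j J)
  have "(\<Sum>C\<in>Pow J. union_diff F C (B \<union> (insert j J - C))) = (\<Sum>C\<in>Pow J. union_diff F C (insert j B \<union> (J - C)))"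
    using insert.hyps by (intro sum.cong refl arg_cong[where f = "union_diff F _"]) auto
  moreover have "(\<Sum>C\<in>Pow J. union_diff F (insert j C) (B \<union> (insert j J - insert j C))) =
    (\<Sum>C\<in>Pow J. union_diff F C (B \<union> (J - C)) - union_diff F C (insert j B \<union> (J - C)))"
  proof (rule sum.cong[OF refl])
    fix C assume C: "C \<in> Pow J"
    then have "insert j J - insert j C = J - C" using insert.hyps by auto
    moreover have "finite C" "j \<notin> C" using C insert.hyps finite_subset by auto
    ultimately show "union_diff F (insert j C) (B \<union> (insert j J - insert j C)) =
      union_diff F C (B \<union> (J - C)) - union_diff F C (insert j B \<union> (J - C))"
      by (simp add: union_diff_insert)
  qed
  ultimately show ?case
    by (simp add: sum_Pow_insert[OF insert.hyps] sum_subtractf insert.IH)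
qed (simp add: union_diff_empty)

text \<open>The sets C that avoid B are the subsets of \<open>J - B\<close>; the inversion formula
  based at B shows that they account for F B out of the total F {}. When F {} = 0, the shocks
  meeting B thus have total intensity F B, the intensity being \<open>union_diff\<close> with the
  opposite sign.\<close>

lemma sum_union_diff_meeting:
  assumes "finite J" "B \<subseteq> J"
  shows "(\<Sum>C | C \<subseteq> J \<and> C \<inter> B \<noteq> {}. union_diff F C (J - C)) = F {} - F B"
proof -
  have "(\<Sum>C\<in>Pow J. union_diff F C (J - C)) = F {}" using sum_union_diff[OF assms(1), of F "{}"] by simp
  moreover have "(\<Sum>C\<in>Pow (J - B). union_diff F C (J - C)) = (\<Sum>C\<in>Pow (J - B). union_diff F C (B \<union> (J - B - C)))"
    using assms by (intro sum.cong refl arg_cong[where f = "union_diff F _"]) auto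
  then have "(\<Sum>C\<in>Pow (J - B). union_diff F C (J - C)) = F B"
    using sum_union_diff[of "J - B" F B] assms by simp
  moreover have "Pow J = Pow (J - B) \<union> {C. C \<subseteq> J \<and> C \<inter> B \<noteq> {}}" by auto
  then have "(\<Sum>C\<in>Pow J. union_diff F C (J - C)) =
    (\<Sum>C\<in>Pow (J - B). union_diff F C (J - C)) + (\<Sum>C | C \<subseteq> J \<and> C \<inter> B \<noteq> {}. union_diff F C (J - C))"
    using assms by (simp only:) (rule sum.union_disjoint, auto)
  ultimately show ?thesis by simp
qed

text \<open>Induction from large B to small B: the probability of containing B is the mass at B plus
  the masses at strictly larger sets, which are already known to agree.\<close>

lemma pmf_eq_superset_probs:
  assumes "finite J" "set_pmf p \<subseteq> Pow J" "set_pmf q \<subseteq> Pow J"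
    and eq: "\<And>B. B \<subseteq> J \<Longrightarrow> measure_pmf.prob p {T. B \<subseteq> T} = measure_pmf.prob q {T. B \<subseteq> T}"
  shows "p = q"
proof (rule pmf_eqI)
  fix B
  have *: "measure_pmf.prob r {T. B \<subseteq> T} = pmf r B + (\<Sum>T | B \<subset> T \<and> T \<subseteq> J. pmf r T)"
    if "set_pmf r \<subseteq> Pow J" "B \<subseteq> J" for r B
  proof -
    have "measure_pmf.prob r {T. B \<subseteq> T} = measure_pmf.prob r ({T. B \<subseteq> T} \<inter> set_pmf r)"
      by (simp add: measure_Int_set_pmf)
    also have "\<dots> = measure_pmf.prob r ({T. B \<subseteq> T \<and> T \<subseteq> J} \<inter> set_pmf r)"
      using that by (intro arg_cong[where f = "measure_pmf.prob r"]) auto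
    also have "\<dots> = measure_pmf.prob r (insert B {T. B \<subset> T \<and> T \<subseteq> J})"
      using that by (subst measure_Int_set_pmf) (intro arg_cong[where f = "measure_pmf.prob r"], auto)
    also have "\<dots> = (\<Sum>T\<in>insert B {T. B \<subset> T \<and> T \<subseteq> J}. pmf r T)"
      using assms(1) by (intro measure_measure_pmf_finite) auto
    finally show ?thesis using assms(1) by simp
  qed
  have "pmf p B = pmf q B" if "B \<subseteq> J" for B
    using that
  proof (induction "card (J - B)" arbitrary: B rule: less_induct)
    case less
    have "(\<Sum>T | B \<subset> T \<and> T \<subseteq> J. pmf p T) = (\<Sum>T | B \<subset> T \<and> T \<subseteq> J. pmf q T)"
      using assms(1) by (intro sum.cong refl less.hyps) (auto intro!: psubset_card_mono)
    then show ?case using *[OF assms(2) less.prems] *[OF assms(3) less.prems] eq[OF less.prems] by simp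
  qed
  moreover have "pmf p B = 0" "pmf q B = 0" if "\<not> B \<subseteq> J"
    using assms that by (auto simp: pmf_eq_0_set_pmf)
  ultimately show "pmf p B = pmf q B" by (cases "B \<subseteq> J") auto
qed

section \<open>Random subsets with prescribed survival probabilities\<close>

locale alternating_set_function =
  fixes I :: "'i set" and F :: "'i set \<Rightarrow> real"
  assumes F_empty: "F {} = 0"
    and alternating: "\<And>B C. finite B \<Longrightarrow> B \<subseteq> I \<Longrightarrow> finite C \<Longrightarrow> C \<subseteq> I \<Longrightarrow> C \<noteq> {} \<Longrightarrow> union_diff F C B \<le> 0"
begin

text \<open>Independent shocks hit the nonempty subsets \<open>C\<close> of \<open>J\<close>, the shock \<open>C\<close> occurring with
  probability \<open>1 - exp (- \<nu> C)\<close>, where \<open>\<nu>\<close> is the Moebius inverse of \<open>F\<close>; an index survives if no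
  shock containing it occurs, so that a whole set \<open>B\<close> survives with probability \<open>exp (- F B)\<close>.\<close>

definition survivors :: "'i set \<Rightarrow> 'i set pmf" where
  "survivors J = map_pmf (\<lambda>x. {j\<in>J. \<forall>C. C \<subseteq> J \<and> j \<in> C \<longrightarrow> \<not> x C})
     (Pi_pmf (Pow J) False (\<lambda>C. bernoulli_pmf (1 - exp (union_diff F C (J - C)))))"

lemma set_survivors: "set_pmf (survivors J) \<subseteq> Pow J"
  unfolding survivors_def by auto

text \<open>B survives iff no shock that meets B occurs. By independence the probability is a
  product of exponentials, whose exponents are summed by
  \<open>sum_union_diff_meeting\<close>.\<close>

lemma prob_survivors:
  assumes J: "finite J" "J \<subseteq> I" and B: "B \<subseteq> J"
  shows "measure_pmf.prob (survivors J) {T. B \<subseteq> T} = exp (- F B)"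
proof -
  define p where "p = (\<lambda>C. bernoulli_pmf (1 - exp (union_diff F C (J - C))))"
  \<comment> \<open>Alternation makes the exponent nonpositive, so the Bernoulli parameter lies in
    [0, 1]. It is available for nonempty C; the empty shock meets no B and enters the product below
    through the sure event.\<close>
  have p: "pmf (p C) False = exp (union_diff F C (J - C))" if "C \<subseteq> J" "C \<noteq> {}" for C
  proof -
    have "union_diff F C (J - C) \<le> 0"
      using J that by (intro alternating) (auto intro: finite_subset)
    then show ?thesis unfolding p_def by (subst pmf_bernoulli_False) auto
  qed
  have "(\<lambda>x. {j\<in>J. \<forall>C. C \<subseteq> J \<and> j \<in> C \<longrightarrow> \<not> x C}) -` {T. B \<subseteq> T} =
    Pi (Pow J) (\<lambda>C. if C \<inter> B \<noteq> {} then {False} else UNIV)"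
    (is "?l = ?r")
  proof (rule set_eqI)
    fix x :: "'i set \<Rightarrow> bool"
    have "x \<in> ?l \<longleftrightarrow> (\<forall>j\<in>B. \<forall>C. C \<subseteq> J \<and> j \<in> C \<longrightarrow> \<not> x C)" using B by auto
    also have "\<dots> \<longleftrightarrow> (\<forall>C. C \<subseteq> J \<longrightarrow> C \<inter> B \<noteq> {} \<longrightarrow> \<not> x C)" by blast
    also have "\<dots> \<longleftrightarrow> x \<in> ?r" by (auto simp: Pi_iff)
    finally show "x \<in> ?l \<longleftrightarrow> x \<in> ?r" .
  qed
  then have "measure_pmf.prob (survivors J) {T. B \<subseteq> T} =
    measure_pmf.prob (Pi_pmf (Pow J) False p) (Pi (Pow J) (\<lambda>C. if C \<inter> B \<noteq> {} then {False} else UNIV))"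
    by (simp add: survivors_def p_def)
  also have "\<dots> = (\<Prod>C\<in>Pow J. measure_pmf.prob (p C) (if C \<inter> B \<noteq> {} then {False} else UNIV))"
    using J by (intro measure_Pi_pmf_Pi) auto
  also have "\<dots> = (\<Prod>C\<in>Pow J. if C \<inter> B \<noteq> {} then exp (union_diff F C (J - C)) else 1)"
    using p by (intro prod.cong refl) (auto simp: measure_pmf_single)
  also have "\<dots> = (\<Prod>C | C \<subseteq> J \<and> C \<inter> B \<noteq> {}. exp (union_diff F C (J - C)))"
    using J by (subst prod.inter_filter[symmetric]) (auto intro!: prod.cong)
  also have "\<dots> = exp (\<Sum>C | C \<subseteq> J \<and> C \<inter> B \<noteq> {}. union_diff F C (J - C))"
    using J by (subst exp_sum) auto
  finally show ?thesis using J B by (simp add: sum_union_diff_meeting F_empty)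
qed

text \<open>The probability of {T. B \<subseteq> T} does not depend on the ambient index set, and
  these probabilities determine the law. Hence the laws are consistent.\<close>

lemma survivors_restrict:
  assumes "finite H" "H \<subseteq> I" "J \<subseteq> H"
  shows "map_pmf (\<lambda>T. T \<inter> J) (survivors H) = survivors J"
proof (rule pmf_eq_superset_probs)
  show "finite J" using assms finite_subset by blast
  show "set_pmf (map_pmf (\<lambda>T. T \<inter> J) (survivors H)) \<subseteq> Pow J" by auto
  show "set_pmf (survivors J) \<subseteq> Pow J" by (rule set_survivors)
  fix B assume "B \<subseteq> J"
  then have "(\<lambda>T. T \<inter> J) -` {T. B \<subseteq> T} = {T. B \<subseteq> T}" by auto
  then show "measure_pmf.prob (map_pmf (\<lambda>T. T \<inter> J) (survivors H)) {T. B \<subseteq> T} = measure_pmf.prob (survivors J) {T. B \<subseteq> T}"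
    using assms \<open>B \<subseteq> J\<close> \<open>finite J\<close> by (simp add: prob_survivors)
qed

text \<open>Random sets are recorded by real indicator functions because the projective limit is
  taken over products of copies of a Polish space, here the reals.\<close>

definition survivor_law :: "'i set \<Rightarrow> ('i \<Rightarrow> real) measure" where
  "survivor_law J = distr (measure_pmf (survivors J)) (PiM J (\<lambda>_. borel)) (\<lambda>T. \<lambda>j\<in>J. indicator T j)"

lemma indicator_restrict_measurable:
  "(\<lambda>T. \<lambda>j\<in>J. indicator T j) \<in> measure_pmf p \<rightarrow>\<^sub>M PiM J (\<lambda>_. borel :: real measure)"
  by (auto simp: space_PiM)

lemma survivor_law_projective: "polish_projective I survivor_law"
proof (intro polish_projective.intro projective_family.intro)
  fix J H :: "'i set" assume JH: "J \<subseteq> H" "finite H" "H \<subseteq> I"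
  have "survivor_law J = distr (map_pmf (\<lambda>T. T \<inter> J) (survivors H)) (PiM J (\<lambda>_. borel)) (\<lambda>T. \<lambda>j\<in>J. indicator T j)"
    using JH by (simp add: survivor_law_def survivors_restrict)
  also have "\<dots> = distr (survivors H) (PiM J (\<lambda>_. borel)) ((\<lambda>T. \<lambda>j\<in>J. indicator T j) \<circ> (\<lambda>T. T \<inter> J))"
    unfolding map_pmf_rep_eq by (intro distr_distr) (auto simp: space_PiM)
  also have "(\<lambda>T. \<lambda>j\<in>J. indicator T j :: real) \<circ> (\<lambda>T. T \<inter> J) = (\<lambda>f. restrict f J) \<circ> (\<lambda>T. \<lambda>j\<in>H. indicator T j)"
    using JH by (auto simp: fun_eq_iff indicator_def)
  also have "distr (survivors H) (PiM J (\<lambda>_. borel)) \<dots> = distr (survivor_law H) (PiM J (\<lambda>_. borel)) (\<lambda>f. restrict f J)"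
    unfolding survivor_law_def using JH
    by (intro distr_distr[symmetric] measurable_restrict_subset indicator_restrict_measurable)
  finally show "survivor_law J = distr (survivor_law H) (PiM J (\<lambda>_. borel)) (\<lambda>f. restrict f J)" .
next
  fix J :: "'i set" assume "finite J" "J \<subseteq> I"
  show "prob_space (survivor_law J)"
    unfolding survivor_law_def by (intro measure_pmf.prob_space_distr indicator_restrict_measurable)
qed

lemma ex_events:
  obtains M :: "('i \<Rightarrow> real) measure" and A where "prob_space M" "\<And>i. i \<in> I \<Longrightarrow> A i \<in> sets M"
    "\<And>B. finite B \<Longrightarrow> B \<subseteq> I \<Longrightarrow> measure M {\<omega>\<in>space M. \<forall>i\<in>B. \<omega> \<in> A i} = exp (- F B)"
proof -
  interpret polish_projective I survivor_law by (rule survivor_law_projective)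
  define A where "A i = {\<omega>\<in>space lim. \<omega> i = 1}" for i
  show thesis
  proof
    show "prob_space lim" by (rule P.prob_space_axioms)
    have sets: "sets lim = sets (PiM I (\<lambda>_. borel))" by (rule sets_lim)
    show "A i \<in> sets lim" if "i \<in> I" for i
    proof -
      have "(\<lambda>\<omega>. \<omega> i) \<in> lim \<rightarrow>\<^sub>M borel"
        unfolding measurable_cong_sets[OF sets refl] using that by (rule measurable_component_singleton)
      from measurable_sets[OF this, of "{1}"] show ?thesis by (simp add: A_def vimage_def Int_def conj_commute)
    qed
    fix B assume B: "finite B" "B \<subseteq> I"
    have "{\<omega>\<in>space lim. \<forall>i\<in>B. \<omega> \<in> A i} = emb I B (PiE B (\<lambda>_. {1}))"
      using B sets_eq_imp_space_eq[OF sets]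
      by (auto simp: A_def prod_emb_def space_PiM PiE_def Pi_def restrict_def fun_eq_iff) metis
    moreover have meas: "PiE B (\<lambda>_. {1}) \<in> sets (PiM B (\<lambda>_. borel :: real measure))"
      using B by (intro sets_PiM_I_finite) auto
    ultimately have "measure lim {\<omega>\<in>space lim. \<forall>i\<in>B. \<omega> \<in> A i} = measure (survivor_law B) (PiE B (\<lambda>_. {1}))"
      using B by (simp add: measure_lim_emb)
    also have "\<dots> = measure_pmf.prob (survivors B) ((\<lambda>T. \<lambda>j\<in>B. indicator T j) -` (PiE B (\<lambda>_. {1 :: real})) \<inter> space (survivors B))"
      unfolding survivor_law_def by (rule measure_distr[OF indicator_restrict_measurable meas])
    also have "(\<lambda>T. \<lambda>j\<in>B. indicator T j) -` (PiE B (\<lambda>_. {1 :: real})) \<inter> space (survivors B) = {T. B \<subseteq> T}"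
      by (auto simp: restrict_def fun_eq_iff indicator_def) (metis of_bool_eq_1_iff)
    finally show "measure lim {\<omega>\<in>space lim. \<forall>i\<in>B. \<omega> \<in> A i} = exp (- F B)"
      using prob_survivors[OF B order_refl] by simp
  qed
qed

end

section \<open>Upper semicontinuous functions\<close>

lemma USC_nonneg: "f \<in> USC \<Longrightarrow> 0 \<le> f x"
  by (simp add: USC_def)

lemma USC_open_less: "f \<in> USC \<Longrightarrow> open {x. f x < t}"
  by (simp add: USC_def upper_semicont_def)

lemma USC_compact_support: "f \<in> USC \<Longrightarrow> compact (closure {x. f x \<noteq> 0})"
  by (simp add: USC_def)

lemma USC_I:
  fixes f :: "'a::t2_space \<Rightarrow> real"
  assumes "\<And>x. 0 \<le> f x" "\<And>x. f x \<le> b" "\<And>t. open {x. f x < t}" "compact K" "\<And>x. f x \<noteq> 0 \<Longrightarrow> x \<in> K"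
  shows "f \<in> USC"
proof -
  have "closure {x. f x \<noteq> 0} \<subseteq> K"
    using assms(4,5) compact_imp_closed by (intro closure_minimal) auto
  then have "compact (closure {x. f x \<noteq> 0})"
    using compact_Int_closed[OF assms(4) closed_closure, of "{x. f x \<noteq> 0}"] by (simp add: inf.absorb2)
  moreover have "bounded (range f)"
    using assms(1,2) by (auto simp: bounded_iff intro!: exI[of _ b])
  ultimately show ?thesis using assms(1,3) by (simp add: USC_def upper_semicont_def)
qed

lemma USC_bound: "f \<in> USC \<Longrightarrow> \<exists>b. \<forall>x. f x \<le> b"
  by (auto simp: USC_def bounded_iff intro: order_trans[OF abs_ge_self])

lemma USC_zero: "(\<lambda>x. 0) \<in> USC"
  by (auto simp: USC_def upper_semicont_def)

lemma USC_max:
  fixes f g :: "'a::t2_space \<Rightarrow> real"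
  assumes f: "f \<in> USC" and g: "g \<in> USC"
  shows "(\<lambda>x. max (f x) (g x)) \<in> USC"
proof -
  obtain a b where ab: "\<And>x. f x \<le> a" "\<And>x. g x \<le> b" using USC_bound[OF f] USC_bound[OF g] by blast
  show ?thesis
  proof (rule USC_I)
    show "0 \<le> max (f x) (g x)" for x using USC_nonneg[OF f] by (simp add: le_max_iff_disj)
    show "max (f x) (g x) \<le> max a b" for x using ab by (meson max.mono)
    show "open {x. max (f x) (g x) < t}" for t
      using open_Int[OF USC_open_less[OF f, of t] USC_open_less[OF g, of t]] by (simp add: Int_def)
    show "compact (closure {x. f x \<noteq> 0} \<union> closure {x. g x \<noteq> 0})"
      using USC_compact_support f g by (intro compact_Un)
    show "x \<in> closure {x. f x \<noteq> 0} \<union> closure {x. g x \<noteq> 0}" if "max (f x) (g x) \<noteq> 0" for x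
      using that subsetD[OF closure_subset, of x "{x. f x \<noteq> 0}"] subsetD[OF closure_subset, of x "{x. g x \<noteq> 0}"]
      by (auto simp: max_def split: if_splits)
  qed
qed

lemma USC_mult_left:
  fixes f :: "'a::t2_space \<Rightarrow> real"
  assumes f: "f \<in> USC" and c: "0 < c"
  shows "(\<lambda>x. c * f x) \<in> USC"
proof -
  obtain b where "\<And>x. f x \<le> b" using USC_bound[OF f] by blast
  then show ?thesis
  proof (intro USC_I[where b = "c * b" and K = "closure {x. f x \<noteq> 0}"])
    show "open {x. c * f x < t}" for t
      using USC_open_less[OF f, of "t / c"] c by (simp add: pos_less_divide_eq mult.commute)
  qed (use USC_nonneg[OF f] USC_compact_support[OF f] c subsetD[OF closure_subset, of _ "{x. f x \<noteq> 0}"] in auto)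
qed

lemma USC_indicator:
  fixes K :: "'a::t2_space set"
  assumes "compact K" "0 \<le> q"
  shows "(\<lambda>x. q * indicator K x) \<in> USC"
proof (rule USC_I[where b = q and K = K])
  show "open {x. q * indicator K x < t}" for t
  proof -
    have "{x. q * indicator K x < t} = (if q < t then UNIV else if 0 < t then - K else {})"
      using assms(2) by (auto simp: indicator_def)
    then show ?thesis using compact_imp_closed[OF assms(1)] by auto
  qed
qed (use assms in \<open>auto simp: indicator_def\<close>)

section \<open>Finite maxima and the set functions they induce\<close>

definition max_over :: "('i \<Rightarrow> 'a \<Rightarrow> real) \<Rightarrow> 'i set \<Rightarrow> 'a \<Rightarrow> real" where
  "max_over h B x = Max (insert 0 ((\<lambda>i. h i x) ` B))"

text \<open>The extra 0 in \<open>max_over\<close> makes the empty maximum the neutral element for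
  maxima in USC, so that the induced set function vanishes at the empty set when L is
  homogeneous.\<close>

lemma max_over_empty: "max_over h {} = (\<lambda>x. 0)"
  by (simp add: max_over_def fun_eq_iff)

lemma max_over_insert:
  "finite B \<Longrightarrow> max_over h (insert i B) = (\<lambda>x. max (max_over h B x) (h i x))"
  by (rule ext) (simp add: max_over_def insert_commute[of 0] max.commute)

lemma max_over_le_iff:
  "finite B \<Longrightarrow> max_over h B x \<le> c \<longleftrightarrow> 0 \<le> c \<and> (\<forall>i\<in>B. h i x \<le> c)"
  by (simp add: max_over_def)

lemma max_over_less_iff:
  "finite B \<Longrightarrow> max_over h B x < c \<longleftrightarrow> 0 < c \<and> (\<forall>i\<in>B. h i x < c)"
  by (simp add: max_over_def)

lemma max_over_nonneg: "finite B \<Longrightarrow> 0 \<le> max_over h B x"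
  by (simp add: max_over_def)

lemma max_over_upper: "finite B \<Longrightarrow> i \<in> B \<Longrightarrow> h i x \<le> max_over h B x"
  by (simp add: max_over_def)

lemma USC_max_over:
  fixes h :: "'i \<Rightarrow> 'a::t2_space \<Rightarrow> real"
  shows "finite B \<Longrightarrow> (\<And>i. i \<in> B \<Longrightarrow> h i \<in> USC) \<Longrightarrow> max_over h B \<in> USC"
  by (induction B rule: finite_induct) (simp_all add: max_over_empty USC_zero max_over_insert USC_max)

text \<open>Adjoining an index to B means taking a maximum with the corresponding function, so the
  two recursions agree. The list is distinct because \<open>union_diff\<close> runs over a set and
  cannot repeat an index.\<close>

lemma max_diff_max_over:
  assumes "distinct cs" "finite B"
  shows "max_diff L (map h cs) (max_over h B) = union_diff (\<lambda>B. L (max_over h B)) (set cs) B"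
  using assms
proof (induction cs arbitrary: B)
  case (Cons c cs)
  have "max_diff L (map h (c # cs)) (max_over h B) =
    max_diff L (map h cs) (max_over h B) - max_diff L (map h cs) (max_over h (insert c B))"
    using Cons.prems by (simp add: max_over_insert)
  then show ?case using Cons by (simp add: union_diff_insert)
qed (simp add: union_diff_empty)

lemma homogeneous_zero:
  assumes "homogeneous_functional (L :: ('a::topological_space \<Rightarrow> real) \<Rightarrow> real)"
  shows "L (\<lambda>x. 0) = 0"
proof -
  have "L (\<lambda>x. 2 * (\<lambda>x. 0 :: real) x) = 2 * L (\<lambda>x. 0)"
    using assms[unfolded homogeneous_functional_def, rule_format, OF zero_less_numeral USC_zero] .
  then show ?thesis by simp
qed

lemma alternating_set_function_max_over:
  fixes h :: "'i \<Rightarrow> 'a::t2_space \<Rightarrow> real"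
  assumes "homogeneous_functional L" and L: "max_completely_alternating L" and h: "\<And>i. i \<in> I \<Longrightarrow> h i \<in> USC"
  shows "alternating_set_function I (\<lambda>B. L (max_over h B))"
proof
  show "L (max_over h {}) = 0" using homogeneous_zero assms(1) by (simp add: max_over_empty)
  fix B C assume BC: "finite B" "B \<subseteq> I" "finite C" "C \<subseteq> I" "C \<noteq> {}"
  obtain cs where cs: "set cs = C" "distinct cs" using finite_distinct_list[OF BC(3)] by blast
  have "max_diff L (map h cs) (max_over h B) \<le> 0"
  proof (rule L[unfolded max_completely_alternating_def, rule_format], intro conjI)
    show "max_over h B \<in> USC" using BC(2) h by (intro USC_max_over[OF BC(1)]) auto
  qed (use BC h cs in auto)
  then show "union_diff (\<lambda>B. L (max_over h B)) C B \<le> 0"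
    using max_diff_max_over[OF cs(2) BC(1), of L h] cs by simp
qed

text \<open>Alternation of order one is monotonicity.\<close>

lemma max_completely_alternating_mono:
  fixes L :: "('a::t2_space \<Rightarrow> real) \<Rightarrow> real"
  assumes "max_completely_alternating L" "f \<in> USC" "g \<in> USC" "\<And>x. f x \<le> g x"
  shows "L f \<le> L g"
proof -
  have "max_diff L [g] f \<le> 0"
    using assms(2,3) by (intro assms(1)[unfolded max_completely_alternating_def, rule_format]) simp
  moreover have "(\<lambda>x. max (f x) (g x)) = g" using assms(4) by (simp add: max_absorb2)
  ultimately show ?thesis by simp
qed

section \<open>Extremal integrals of simple functions, and scaling\<close>

lemma extremal_integral_max_over:
  fixes K :: "'i \<Rightarrow> 'a::{t2_space,second_countable_topology} set"
  assumes lc: "locally_compact_space (euclidean :: 'a topology)" and \<phi>: "sup_measure \<phi>"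
    and B: "finite B" "\<And>i. i \<in> B \<Longrightarrow> 0 \<le> u i"
  shows "extremal_integral \<phi> (max_over (\<lambda>i x. u i * indicator (K i) x) B) = (SUP i\<in>B. ennreal (u i) * \<phi> (K i))"
    (is "extremal_integral \<phi> ?f = _")
proof -
  have "extremal_integral \<phi> ?f = (SUP x. \<phi> {x} * ennreal (?f x))"
    by (rule extremal_integral_eq_SUP[OF lc \<phi>]) (rule max_over_nonneg[OF B(1)])
  also have "\<dots> = (SUP i\<in>B. ennreal (u i) * \<phi> (K i))"
  proof (intro antisym SUP_least)
    fix x
    show "\<phi> {x} * ennreal (?f x) \<le> (SUP i\<in>B. ennreal (u i) * \<phi> (K i))"
    \<comment> \<open>A nonzero maximum at x is attained by some index i with x in
      \<open>K i\<close>, and its value is then the full weight \<open>u i\<close>.\<close>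
    proof (cases "?f x = 0")
      case False
      have "?f x \<in> insert 0 ((\<lambda>i. u i * indicator (K i) x) ` B)"
        unfolding max_over_def using B(1) by (intro Max_in) auto
      then obtain i where i: "i \<in> B" "?f x = u i * indicator (K i) x" using False by auto
      then have x: "x \<in> K i" "?f x = u i" using False by (auto simp: indicator_def split: if_splits)
      have "\<phi> {x} \<le> \<phi> (K i)" using x by (intro sup_measure_mono[OF \<phi>]) auto
      then have "\<phi> {x} * ennreal (?f x) \<le> ennreal (u i) * \<phi> (K i)"
        unfolding x(2) by (simp add: mult.commute mult_left_mono)
      then show ?thesis using i(1) by (rule SUP_upper2[rotated])
    qed simp
  next
    fix i assume i: "i \<in> B"
    have "ennreal (u i) * \<phi> (K i) = (SUP x\<in>K i. ennreal (u i) * \<phi> {x})"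
      by (subst sup_measure_eq_SUP[OF lc \<phi>]) (simp add: SUP_mult_left_ennreal)
    also have "\<dots> \<le> (SUP x. \<phi> {x} * ennreal (?f x))"
    proof (rule SUP_mono)
      fix x assume "x \<in> K i"
      then have "u i \<le> ?f x" using max_over_upper[OF B(1) i, of "\<lambda>i x. u i * indicator (K i) x" x] by simp
      then have "ennreal (u i) * \<phi> {x} \<le> \<phi> {x} * ennreal (?f x)"
        by (subst mult.commute) (simp add: mult_left_mono ennreal_leI)
      then show "\<exists>y\<in>UNIV. ennreal (u i) * \<phi> {x} \<le> \<phi> {y} * ennreal (?f y)" by blast
    qed
    finally show "ennreal (u i) * \<phi> (K i) \<le> (SUP x. \<phi> {x} * ennreal (?f x))" .
  qed
  finally show ?thesis .
qed

lemma extremal_integral_mult_left: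
  fixes f :: "'a::{t2_space,second_countable_topology} \<Rightarrow> real"
  assumes lc: "locally_compact_space (euclidean :: 'a topology)" and \<phi>: "sup_measure \<phi>"
    and "\<And>x. 0 \<le> f x" "0 \<le> c"
  shows "extremal_integral \<phi> (\<lambda>x. c * f x) = ennreal c * extremal_integral \<phi> f"
proof -
  have "extremal_integral \<phi> (\<lambda>x. c * f x) = (SUP x. \<phi> {x} * ennreal (c * f x))"
    using assms by (intro extremal_integral_eq_SUP) auto
  also have "\<dots> = (SUP x. ennreal c * (\<phi> {x} * ennreal (f x)))"
    using assms by (simp add: ennreal_mult mult_ac)
  also have "\<dots> = ennreal c * (SUP x. \<phi> {x} * ennreal (f x))" by (simp add: SUP_mult_left_ennreal)
  finally show ?thesis using assms by (simp add: extremal_integral_eq_SUP)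
qed

lemma extremal_integral_indicator:
  fixes K :: "'a::{t2_space,second_countable_topology} set"
  assumes lc: "locally_compact_space (euclidean :: 'a topology)" and \<phi>: "sup_measure \<phi>"
  shows "extremal_integral \<phi> (indicator K) = \<phi> K"
proof -
  have "(indicator K :: 'a \<Rightarrow> real) = max_over (\<lambda>i x. 1 * indicator K x) {()}"
    by (auto simp: max_over_def indicator_def)
  then show ?thesis using extremal_integral_max_over[OF assms, of "{()}" "\<lambda>_. 1" "\<lambda>_. K"] by simp
qed

section \<open>Boxes\<close>

locale relatively_compact_base =
  fixes \<U> :: "'a::{t2_space,second_countable_topology} set set"
  assumes \<U>_countable: "countable \<U>"
    and \<U>_open: "\<And>U. U \<in> \<U> \<Longrightarrow> open U"
    and \<U>_compact: "\<And>U. U \<in> \<U> \<Longrightarrow> compact (closure U)"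
    and \<U>_Int: "\<And>U V. U \<in> \<U> \<Longrightarrow> V \<in> \<U> \<Longrightarrow> U \<inter> V \<in> \<U>"
    and \<U>_basis: "\<And>x G. open G \<Longrightarrow> x \<in> G \<Longrightarrow> \<exists>U\<in>\<U>. x \<in> U \<and> closure U \<subseteq> G"
begin

section \<open>Coverings of upper semicontinuous functions by boxes\<close>

definition boxes :: "('a set \<times> real) set" where
  "boxes = \<U> \<times> (\<rat> \<inter> {0<..})"

text \<open>The closure makes the function upper semicontinuous; \<open>covers\<close> and the
  density work with the open set \<open>fst p\<close> itself.\<close>

definition box_fun :: "'a set \<times> real \<Rightarrow> 'a \<Rightarrow> real" where
  "box_fun p x = snd p * indicator (closure (fst p)) x"

text \<open>For upper semicontinuous f and boxes with open base, the strict inequality makes the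
  condition at x persist nearby, so finite coverings can be extracted by compactness of the closed
  support.\<close>

definition covers :: "('a set \<times> real) set \<Rightarrow> ('a \<Rightarrow> real) \<Rightarrow> bool" where
  "covers B f \<longleftrightarrow> (\<forall>x\<in>closure {x. f x \<noteq> 0}. \<exists>p\<in>B. x \<in> fst p \<and> f x < snd p)"

text \<open>A smaller set and a smaller value, hence a larger bound \<open>1 / q\<close>: the bound
  expressed by p' implies the one expressed by p.\<close>

definition below_box :: "'a set \<times> real \<Rightarrow> 'a set \<times> real \<Rightarrow> bool" where
  "below_box p p' \<longleftrightarrow> fst p \<subseteq> fst p' \<and> snd p \<le> snd p'"

definition refines :: "('a set \<times> real) set \<Rightarrow> ('a set \<times> real) set \<Rightarrow> bool" where
  "refines B C \<longleftrightarrow> (\<forall>p\<in>B. \<exists>p'\<in>C. below_box p p')"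

definition covering_sets :: "('a \<Rightarrow> real) \<Rightarrow> ('a set \<times> real) set set" where
  "covering_sets f = {B. finite B \<and> B \<subseteq> boxes \<and> covers B f}"

lemma countable_boxes: "countable boxes"
  unfolding boxes_def using \<U>_countable countable_rat by (intro countable_SIGMA) auto

lemma countable_covering_sets: "countable (covering_sets f)"
  unfolding covering_sets_def
  by (rule countable_subset[OF _ countable_Collect_finite_subset[OF countable_boxes]]) auto

lemma box_fun_USC: "p \<in> boxes \<Longrightarrow> box_fun p \<in> USC"
  unfolding boxes_def box_fun_def using \<U>_compact by (intro USC_indicator) auto

lemma max_over_box_fun_USC: "finite B \<Longrightarrow> B \<subseteq> boxes \<Longrightarrow> max_over box_fun B \<in> USC"
  using box_fun_USC by (intro USC_max_over) auto

lemma below_box_fun_le: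
  assumes "p' \<in> boxes" "below_box p p'"
  shows "box_fun p x \<le> box_fun p' x"
  using assms closure_mono[of "fst p" "fst p'"]
  by (auto simp: below_box_def boxes_def box_fun_def indicator_def)

lemma refines_max_over_le:
  assumes "finite B" "finite C" "C \<subseteq> boxes" "refines B C"
  shows "max_over box_fun B x \<le> max_over box_fun C x"
proof -
  have "box_fun p x \<le> max_over box_fun C x" if "p \<in> B" for p
  proof -
    obtain p' where p': "p' \<in> C" "below_box p p'" using assms(4) \<open>p \<in> B\<close> by (auto simp: refines_def)
    then have "box_fun p x \<le> box_fun p' x" using assms(3) by (intro below_box_fun_le) auto
    also have "\<dots> \<le> max_over box_fun C x" using assms(2) p' by (intro max_over_upper)
    finally show ?thesis .
  qed
  then show ?thesis using assms by (simp add: max_over_le_iff max_over_nonneg)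
qed

lemma refines_refl: "refines B B"
  by (auto simp: refines_def below_box_def)

lemma covers_le_max_over:
  assumes "f \<in> USC" "covers B f" "finite B" "B \<subseteq> boxes"
  shows "f x \<le> max_over box_fun B x"
proof (cases "f x = 0")
  case False
  then have "x \<in> closure {x. f x \<noteq> 0}" using closure_subset[of "{x. f x \<noteq> 0}"] by auto
  then obtain p where p: "p \<in> B" "x \<in> fst p" "f x < snd p" using assms(2) by (auto simp: covers_def)
  then have "f x \<le> box_fun p x" using subsetD[OF closure_subset, of x "fst p"] by (simp add: box_fun_def)
  also have "\<dots> \<le> max_over box_fun B x" using assms(3) p(1) by (rule max_over_upper)
  finally show ?thesis .
qed (use assms in \<open>simp add: max_over_nonneg\<close>)

definition meet :: "('a set \<times> real) set \<Rightarrow> ('a set \<times> real) set \<Rightarrow> ('a set \<times> real) set" where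
  "meet B C = (\<lambda>(p, p'). (fst p \<inter> fst p', min (snd p) (snd p'))) ` (B \<times> C)"

lemma meet_covering:
  assumes "B \<in> covering_sets f" "C \<in> covering_sets f"
  shows "meet B C \<in> covering_sets f"
proof -
  have "meet B C \<subseteq> boxes"
    using assms \<U>_Int by (fastforce simp: meet_def covering_sets_def boxes_def min_def)
  moreover have "covers (meet B C) f"
    unfolding covers_def
  proof
    fix x assume x: "x \<in> closure {x. f x \<noteq> 0}"
    obtain p p' where "p \<in> B" "x \<in> fst p" "f x < snd p" "p' \<in> C" "x \<in> fst p'" "f x < snd p'"
      using assms x unfolding covering_sets_def covers_def by blast
    then show "\<exists>r\<in>meet B C. x \<in> fst r \<and> f x < snd r"
      unfolding meet_def by (intro bexI[OF _ imageI[of "(p, p')"]]) auto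
  qed
  ultimately show ?thesis using assms by (auto simp: covering_sets_def meet_def)
qed

lemma meet_refines: "refines (meet B C) B" "refines (meet B C) C"
  by (fastforce simp: refines_def meet_def below_box_def)+

lemma ex_rat_box_value:
  fixes a b :: real
  assumes "0 \<le> a" "a < b"
  shows "\<exists>q\<in>\<rat> \<inter> {0<..}. a < q \<and> q < b"
  using Rats_dense_in_real[OF assms(2)] assms(1) by fastforce

lemma ex_close_covering:
  assumes f: "f \<in> USC" and e: "0 < e"
  shows "\<exists>B\<in>covering_sets f. max_over box_fun B x < f x + e"
proof -
  \<comment> \<open>Only the value at the single point x has to be controlled. Boxes chosen at other
    points y have closures that miss x, so they contribute 0 there; the box chosen at x has a value
    below f x + e.\<close>
  have "\<exists>p\<in>boxes. y \<in> fst p \<and> fst p \<subseteq> {z. f z < snd p} \<and> (x \<in> closure (fst p) \<longrightarrow> snd p < f x + e)" for y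
  proof (cases "y = x")
    case True
    obtain q where q: "q \<in> \<rat> \<inter> {0<..}" "f x < q" "q < f x + e"
      using ex_rat_box_value[of "f x" "f x + e"] USC_nonneg[OF f] e by auto
    obtain U where "U \<in> \<U>" "x \<in> U" "closure U \<subseteq> {z. f z < q}"
      using \<U>_basis[OF USC_open_less[OF f], of x q] q by auto
    then show ?thesis
      using q True closure_subset[of U] by (intro bexI[of _ "(U, q)"]) (auto simp: boxes_def)
  next
    case False
    obtain q where q: "q \<in> \<rat> \<inter> {0<..}" "f y < q"
      using ex_rat_box_value[of "f y" "f y + 1"] USC_nonneg[OF f] by auto
    have "open ({z. f z < q} \<inter> - {x})" using USC_open_less[OF f] by (intro open_Int) auto
    then obtain U where "U \<in> \<U>" "y \<in> U" "closure U \<subseteq> {z. f z < q} \<inter> - {x}"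
      using \<U>_basis[of "{z. f z < q} \<inter> - {x}" y] q False by auto
    then show ?thesis
      using q closure_subset[of U] by (intro bexI[of _ "(U, q)"]) (auto simp: boxes_def)
  qed
  then obtain p where p: "\<And>y. p y \<in> boxes" "\<And>y. y \<in> fst (p y)" "\<And>y. fst (p y) \<subseteq> {z. f z < snd (p y)}"
    "\<And>y. x \<in> closure (fst (p y)) \<Longrightarrow> snd (p y) < f x + e"
    by metis
  have op: "open (fst (p y))" for y using p(1)[of y] \<U>_open by (auto simp: boxes_def)
  have "closure {x. f x \<noteq> 0} \<subseteq> (\<Union>y\<in>UNIV. fst (p y))" using p(2) by auto
  then obtain Y where Y: "finite Y" "closure {x. f x \<noteq> 0} \<subseteq> (\<Union>y\<in>Y. fst (p y))"
    by (rule compactE_image[OF USC_compact_support[OF f] op])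
  have "covers (p ` Y) f" using Y(2) p(3) unfolding covers_def by blast
  then have "p ` Y \<in> covering_sets f" using Y(1) p(1) by (auto simp: covering_sets_def)
  moreover have "max_over box_fun (p ` Y) x < f x + e"
    using Y(1) p(4) USC_nonneg[OF f, of x] e
    by (auto simp: max_over_less_iff box_fun_def indicator_def)
  ultimately show ?thesis by blast
qed

text \<open>\<open>usc_functional\<close> speaks about sequences, while the coverings form a
  directed family. As this family is countable, successive meets along an enumeration give a
  decreasing cofinal sequence, and its majorants descend to f pointwise by
  \<open>ex_close_covering\<close>.\<close>

lemma ex_covering_sequence:
  fixes L :: "('a \<Rightarrow> real) \<Rightarrow> real"
  assumes L: "usc_functional L" and f: "f \<in> USC"
  obtains b where "\<And>n. b n \<in> covering_sets f" "\<And>n. refines (b (Suc n)) (b n)"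
    "\<And>B. B \<in> covering_sets f \<Longrightarrow> \<exists>n. refines (b n) B"
    "(\<lambda>n. L (max_over box_fun (b n))) \<longlonglongrightarrow> L f"
proof -
  define e where "e = from_nat_into (covering_sets f)"
  have ne: "covering_sets f \<noteq> {}" using ex_close_covering[OF f zero_less_one] by auto
  then have e: "e n \<in> covering_sets f" for n unfolding e_def by (rule from_nat_into)
  define b where "b = rec_nat (e 0) (\<lambda>n B. meet B (e (Suc n)))"
  have b0: "b 0 = e 0" and bS: "b (Suc n) = meet (b n) (e (Suc n))" for n by (simp_all add: b_def)
  have b: "b n \<in> covering_sets f" for n
    by (induction n) (simp_all add: b0 bS e meet_covering)
  have ref: "refines (b n) (e n)" for n
    by (cases n) (simp_all add: b0 bS refines_refl meet_refines)
  have dec: "refines (b (Suc n)) (b n)" for n by (simp add: bS meet_refines)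
  have fin: "finite (b n)" "b n \<subseteq> boxes" "covers (b n) f" for n
    using b[of n] by (auto simp: covering_sets_def)
  have cof: "\<exists>n. refines (b n) B" if B: "B \<in> covering_sets f" for B
  proof -
    obtain n where "e n = B"
      using from_nat_into_surj[OF countable_covering_sets B] unfolding e_def by blast
    then show ?thesis using ref[of n] by blast
  qed
  have decseq: "decseq (\<lambda>n. max_over box_fun (b n) x)" for x
    by (intro decseq_SucI refines_max_over_le fin dec)
  moreover have "(\<lambda>n. max_over box_fun (b n) x) \<longlonglongrightarrow> f x" for x
  proof (rule order_tendstoI)
    fix a assume "a < f x"
    then show "eventually (\<lambda>n. a < max_over box_fun (b n) x) sequentially"
      using covers_le_max_over[OF f fin(3) fin(1) fin(2)] by (intro always_eventually allI) (rule less_le_trans)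
  next
    fix a assume "f x < a"
    then obtain B where B: "B \<in> covering_sets f" "max_over box_fun B x < a"
      using ex_close_covering[OF f, of "a - f x" x] by auto
    obtain n where "refines (b n) B" using cof B by blast
    then have "max_over box_fun (b n) x \<le> max_over box_fun B x"
      using B fin by (intro refines_max_over_le) (auto simp: covering_sets_def)
    then have n: "max_over box_fun (b n) x < a" using B(2) by simp
    have "max_over box_fun (b m) x < a" if "n \<le> m" for m
      using decseqD[OF decseq that, of x] n by (rule le_less_trans)
    then show "eventually (\<lambda>n. max_over box_fun (b n) x < a) sequentially"
      by (auto simp: eventually_sequentially)
  qed
  ultimately have "(\<lambda>n. L (max_over box_fun (b n))) \<longlonglongrightarrow> L f"
    using max_over_box_fun_USC[OF fin(1,2)] f
    by (intro conjunct2[OF L[unfolded usc_functional_def, rule_format]]) simp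
  then show thesis using that[OF b dec cof] by blast
qed

text \<open>A family \<open>W\<close> of boxes is read as the collection of bounds \<open>\<phi> U \<le> 1 / q\<close>.\<close>

definition box_density :: "('a set \<times> real) set \<Rightarrow> 'a \<Rightarrow> ennreal" where
  "box_density W x = (INF p\<in>{p\<in>W. x \<in> fst p}. ennreal (1 / snd p))"

definition box_measure :: "('a set \<times> real) set \<Rightarrow> 'a set \<Rightarrow> ennreal" where
  "box_measure W A = (SUP x\<in>A. box_density W x)"

lemma box_density_less_iff: "box_density W x < t \<longleftrightarrow> (\<exists>p\<in>W. x \<in> fst p \<and> ennreal (1 / snd p) < t)"
  unfolding box_density_def INF_less_iff by blast

section \<open>Sup-measures cut out by a family of bounds\<close>

context
  fixes W
  assumes W: "W \<subseteq> boxes" and W_total: "\<And>U. U \<in> \<U> \<Longrightarrow> \<exists>q. (U, q) \<in> W"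
begin

text \<open>Sublevel sets of the density are unions of base sets, hence open. An infimum over no
  bounds would be infinite; \<open>W_total\<close> supplies a bound at every point.\<close>

lemma sup_measure_box_measure: "sup_measure (box_measure W)"
  unfolding box_measure_def
proof (rule sup_measure_SUP)
  fix t
  have "{x. box_density W x < t} = (\<Union>p\<in>{p\<in>W. ennreal (1 / snd p) < t}. fst p)"
    by (auto simp: box_density_less_iff)
  moreover have "open (fst p)" if "p \<in> W" for p
    using that W \<U>_open by (auto simp: boxes_def)
  ultimately show "open {x. box_density W x < t}" by auto
next
  fix x
  obtain U where "U \<in> \<U>" "x \<in> U" using \<U>_basis[of UNIV x] by auto
  moreover then obtain q where "(U, q) \<in> W" using W_total by blast
  ultimately show "box_density W x < \<infinity>"
    by (force simp: box_density_less_iff)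
qed

lemma extremal_integral_box_measure:
  assumes "\<And>x. 0 \<le> f x"
  shows "extremal_integral (box_measure W) f = (SUP x. box_density W x * ennreal (f x))"
proof -
  have lc: "locally_compact_space (euclidean :: 'a topology)"
    unfolding locally_compact_space_def
  proof
    fix x :: 'a
    obtain U where "U \<in> \<U>" "x \<in> U" using \<U>_basis[of UNIV x] by auto
    then show "\<exists>U K. openin euclidean U \<and> compactin euclidean K \<and> x \<in> U \<and> U \<subseteq> K"
      using \<U>_open \<U>_compact closure_subset
      by (intro exI[of _ U] exI[of _ "closure U"]) (auto simp: open_openin[symmetric])
  qed
  have "extremal_integral (box_measure W) f = (SUP x. box_measure W {x} * ennreal (f x))"
    by (intro extremal_integral_eq_SUP lc sup_measure_box_measure assms)
  then show ?thesis by (simp add: box_measure_def)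
qed

lemma covers_imp_extremal_integral_le:
  assumes "B \<subseteq> W" "covers B f" "f \<in> USC"
  shows "extremal_integral (box_measure W) f \<le> 1"
  unfolding extremal_integral_box_measure[OF USC_nonneg[OF assms(3)]]
proof (rule SUP_least)
  fix x
  show "box_density W x * ennreal (f x) \<le> 1"
  proof (cases "f x = 0")
    case False
    then have "x \<in> closure {x. f x \<noteq> 0}" using closure_subset[of "{x. f x \<noteq> 0}"] by auto
    then obtain p where p: "p \<in> B" "x \<in> fst p" "f x < snd p" using assms(2) by (auto simp: covers_def)
    have q: "0 < snd p" using p assms(1) W by (auto simp: boxes_def)
    have "box_density W x \<le> ennreal (1 / snd p)"
      unfolding box_density_def using p assms(1) by (intro INF_lower) auto
    then have "box_density W x * ennreal (f x) \<le> ennreal (1 / snd p) * ennreal (snd p)"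
      using p by (intro mult_mono ennreal_leI) auto
    also have "\<dots> = 1" using q by (simp add: ennreal_mult[symmetric])
    finally show ?thesis .
  qed simp
qed

text \<open>A near converse of \<open>covers_imp_extremal_integral_le\<close>: the strict inequality
  yields at every point a box in W with f x < q, and compactness selects finitely many. At a point
  where density times f equals 1 no such box exists.\<close>

lemma extremal_integral_less_imp_covers:
  assumes f: "f \<in> USC" and less: "extremal_integral (box_measure W) f < 1"
  shows "\<exists>B\<in>covering_sets f. B \<subseteq> W"
proof -
  have "\<exists>p\<in>W. x \<in> fst p \<and> f x < snd p" for x
  \<comment> \<open>The closed support may contain zeros of f; there any box of W around x will do,
    since box values are positive.\<close>
  proof (cases "f x = 0")
    case True
    obtain U where U: "U \<in> \<U>" "x \<in> U" using \<U>_basis[of UNIV x] by auto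
    then obtain q where "(U, q) \<in> W" using W_total by blast
    then show ?thesis using W U True by (force simp: boxes_def)
  next
    case False
    then have fx: "0 < f x" using USC_nonneg[OF f, of x] by simp
    have "box_density W x * ennreal (f x) < 1"
      using less unfolding extremal_integral_box_measure[OF USC_nonneg[OF f]]
      by (rule le_less_trans[rotated]) (auto intro: SUP_upper)
    have "box_density W x < ennreal (1 / f x)"
    proof (rule ccontr)
      assume "\<not> ?thesis"
      then have "ennreal (1 / f x) * ennreal (f x) \<le> box_density W x * ennreal (f x)"
        by (intro mult_right_mono) auto
      moreover have "ennreal (1 / f x) * ennreal (f x) = 1" using fx by (simp add: ennreal_mult[symmetric])
      ultimately show False using \<open>box_density W x * ennreal (f x) < 1\<close> by simp
    qed
    then obtain p where p: "p \<in> W" "x \<in> fst p" "ennreal (1 / snd p) < ennreal (1 / f x)"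
      by (auto simp: box_density_less_iff)
    moreover have "0 < snd p" using p W by (auto simp: boxes_def)
    ultimately have "1 / snd p < 1 / f x" using fx by (simp add: ennreal_less_iff)
    then have "f x < snd p" using fx \<open>0 < snd p\<close> by (simp add: field_simps)
    then show ?thesis using p by blast
  qed
  then obtain p where p: "\<And>x. p x \<in> W" "\<And>x. x \<in> fst (p x)" "\<And>x. f x < snd (p x)" by metis
  have op: "open (fst (p y) \<inter> {z. f z < snd (p y)})" for y
    using p(1)[of y] W \<U>_open USC_open_less[OF f] by (intro open_Int) (auto simp: boxes_def)
  have "closure {x. f x \<noteq> 0} \<subseteq> (\<Union>y\<in>UNIV. fst (p y) \<inter> {z. f z < snd (p y)})" using p(2,3) by auto
  then obtain Y where Y: "finite Y" "closure {x. f x \<noteq> 0} \<subseteq> (\<Union>y\<in>Y. fst (p y) \<inter> {z. f z < snd (p y)})"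
    by (rule compactE_image[OF USC_compact_support[OF f] op])
  have "covers (p ` Y) f" using Y(2) unfolding covers_def by blast
  then have "p ` Y \<in> covering_sets f" "p ` Y \<subseteq> W" using Y(1) p(1) W by (auto simp: covering_sets_def)
  then show ?thesis by blast
qed

end

end

section \<open>Existence\<close>

text \<open>\<open>D t\<close> lies between {Y < t} and {Y \<le> t}, so {Y \<le> t} is the
  intersection of the sets \<open>D (t + 1 / Suc n)\<close>. This gives measurability of Y, and
  continuity of exp (- a / t) in t gives the distribution function.\<close>

lemma unit_frechetI_sandwich:
  assumes "prob_space M" and a: "0 \<le> a"
    and D: "\<And>t. 0 < t \<Longrightarrow> D t \<in> sets M" "\<And>t. 0 < t \<Longrightarrow> measure M (D t) = exp (- a / t)"
    and low: "\<And>t \<omega>. 0 < t \<Longrightarrow> \<omega> \<in> space M \<Longrightarrow> Y \<omega> < ennreal t \<Longrightarrow> \<omega> \<in> D t"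
    and up: "\<And>t \<omega>. 0 < t \<Longrightarrow> \<omega> \<in> D t \<Longrightarrow> Y \<omega> \<le> ennreal t"
  shows "unit_frechet M Y a"
proof -
  interpret prob_space M by fact
  have eq: "{\<omega>\<in>space M. Y \<omega> \<le> ennreal t} = (\<Inter>n. D (t + 1 / Suc n))" if "0 \<le> t" for t
  proof (intro subset_antisym subsetI INT_I)
    fix \<omega> n assume "\<omega> \<in> {\<omega>\<in>space M. Y \<omega> \<le> ennreal t}"
    moreover have "ennreal t < ennreal (t + 1 / Suc n)" using that by (simp add: ennreal_less_iff)
    ultimately show "\<omega> \<in> D (t + 1 / Suc n)"
      using that by (intro low) (auto intro: add_nonneg_pos le_less_trans)
  next
    fix \<omega> assume \<omega>: "\<omega> \<in> (\<Inter>n. D (t + 1 / Suc n))"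
    have "Y \<omega> \<le> ennreal (t + 1 / Suc n)" for n
      using that \<omega> by (intro up) (auto intro: add_nonneg_pos)
    moreover have "(\<lambda>n. ennreal (t + 1 / Suc n)) \<longlonglongrightarrow> ennreal (t + 0)"
      by (intro tendsto_ennrealI tendsto_add tendsto_const LIMSEQ_Suc[OF lim_1_over_n])
    ultimately have "Y \<omega> \<le> ennreal t" by (intro LIMSEQ_le_const) auto
    moreover have "D (t + 1) \<subseteq> space M" using that D(1)[of "t + 1"] sets.sets_into_space by auto
    then have "\<omega> \<in> space M" using INT_D[OF \<omega>, of 0] by auto
    ultimately show "\<omega> \<in> {\<omega>\<in>space M. Y \<omega> \<le> ennreal t}" by simp
  qed
  have pos: "0 < t + 1 / Suc n" if "0 \<le> t" for t n using that by (auto intro: add_nonneg_pos)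
  \<comment> \<open>The level 0 is included because measurability is checked at every extended
    level; at infinity the event is the whole space.\<close>
  have meas: "{\<omega>\<in>space M. Y \<omega> \<le> ennreal t} \<in> sets M" if "0 \<le> t" for t
    unfolding eq[OF that] using D(1)[OF pos[OF that]] by (intro sets.countable_INT) auto
  have "Y \<in> borel_measurable M"
  proof (rule borel_measurableI_le)
    fix y
    show "{\<omega>\<in>space M. Y \<omega> \<le> y} \<in> sets M" by (cases y) (auto intro: meas)
  qed
  moreover have "measure M {\<omega>\<in>space M. Y \<omega> \<le> ennreal t} = exp (- a / t)" if "0 < t" for t
  proof -
    \<comment> \<open>Monotonicity of D comes from the sandwich: for s < t, \<open>D s\<close> lies
      in {Y \<le> s}, hence in {Y < t}, hence in \<open>D t\<close>.\<close>
    have "decseq (\<lambda>n. D (t + 1 / Suc n))"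
    proof (intro decseq_SucI subsetI)
      fix n \<omega> assume \<omega>: "\<omega> \<in> D (t + 1 / Suc (Suc n))"
      then have "\<omega> \<in> space M" using D(1)[OF pos] that sets.sets_into_space by (meson less_imp_le subsetD)
      moreover have "t + 1 / Suc (Suc n) < t + 1 / Suc n" by (simp add: divide_strict_left_mono)
      then have "ennreal (t + 1 / Suc (Suc n)) < ennreal (t + 1 / Suc n)"
        using pos[of t "Suc n"] that by (simp add: ennreal_less_iff)
      then have "Y \<omega> < ennreal (t + 1 / Suc n)" using up[OF pos \<omega>] that by (auto intro: le_less_trans)
      ultimately show "\<omega> \<in> D (t + 1 / Suc n)" using pos that by (intro low) auto
    qed
    then have "(\<lambda>n. measure M (D (t + 1 / Suc n))) \<longlonglongrightarrow> measure M (\<Inter>n. D (t + 1 / Suc n))"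
      using D(1)[OF pos] that by (intro finite_Lim_measure_decseq) auto
    moreover have "(\<lambda>n. exp (- a / (t + 1 / Suc n))) \<longlonglongrightarrow> exp (- a / (t + 0))"
      using that by (intro tendsto_exp tendsto_divide tendsto_add tendsto_const LIMSEQ_Suc[OF lim_1_over_n]) auto
    ultimately show ?thesis
      using eq D(2)[OF pos] that by (auto intro: LIMSEQ_unique)
  qed
  ultimately show ?thesis using a by (simp add: unit_frechet_def)
qed

lemma unit_frechet_cong:
  assumes "\<And>\<omega>. \<omega> \<in> space M \<Longrightarrow> Y \<omega> = Z \<omega>"
  shows "unit_frechet M Y a \<longleftrightarrow> unit_frechet M Z a"
proof -
  have "{\<omega>\<in>space M. Y \<omega> \<le> c} = {\<omega>\<in>space M. Z \<omega> \<le> c}" for c using assms by auto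
  then show ?thesis unfolding unit_frechet_def using measurable_cong[of M Y Z borel, OF assms] by simp
qed

text \<open>The integrals of USC functions contain everything else: \<open>X \<omega> K\<close> is
  the integral of an indicator, which gives measurability of X, and weighted maxima are integrals of
  simple functions, which gives max-stability.\<close>

lemma tail_dependence_functionalI:
  fixes X :: "'m \<Rightarrow> 'a::{t2_space,second_countable_topology} set \<Rightarrow> ennreal"
  assumes lc: "locally_compact_space (euclidean :: 'a topology)" and M: "prob_space M"
    and X: "\<And>\<omega>. \<omega> \<in> space M \<Longrightarrow> sup_measure (X \<omega>)"
    and L: "\<And>f. f \<in> USC \<Longrightarrow> unit_frechet M (\<lambda>\<omega>. extremal_integral (X \<omega>) f) (L f)"
  shows "tail_dependence_functional M X L"
proof -
  have "random_sup_measure M X"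
    unfolding random_sup_measure_def
  proof (intro conjI M measurable_sup_vagueI[OF lc] X)
    fix K :: "'a set" assume K: "compact K"
    have "indicator K \<in> (USC :: ('a \<Rightarrow> real) set)" using USC_indicator[OF K zero_le_one] by simp
    then have "(\<lambda>\<omega>. extremal_integral (X \<omega>) (indicator K)) \<in> borel_measurable M"
      using L by (auto simp: unit_frechet_def)
    then show "(\<lambda>\<omega>. X \<omega> K) \<in> borel_measurable M"
      by (rule measurable_cong[THEN iffD1, rotated]) (simp add: extremal_integral_indicator[OF lc X])
  qed
  moreover have "\<exists>a. unit_frechet M (\<lambda>\<omega>. SUP i\<in>{..<m}. ennreal (u i) * X \<omega> (K i)) a"
    if K: "\<forall>i<m. compact (K i) \<and> 0 \<le> u i" for m :: nat and K :: "nat \<Rightarrow> 'a set" and u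
  proof -
    define f where "f = max_over (\<lambda>i x. u i * indicator (K i) x) {..<m}"
    have f: "f \<in> USC" unfolding f_def using K by (intro USC_max_over USC_indicator) auto
    have *: "extremal_integral (X \<omega>) f = (SUP i\<in>{..<m}. ennreal (u i) * X \<omega> (K i))" if "\<omega> \<in> space M" for \<omega>
      unfolding f_def using K X[OF that] by (intro extremal_integral_max_over[OF lc]) auto
    have "unit_frechet M (\<lambda>\<omega>. SUP i\<in>{..<m}. ennreal (u i) * X \<omega> (K i)) (L f)"
      by (rule unit_frechet_cong[THEN iffD1, OF * L[OF f]])
    then show ?thesis by blast
  qed
  ultimately show ?thesis unfolding tail_dependence_functional_def max_stable_def using L by blast
qed

text \<open>The realising probability space may be transported to any type that contains the values of
  \<open>X\<close>: equip the target with the final sigma-algebra of \<open>X\<close>.\<close>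

lemma tail_dependence_functional_transport:
  fixes X :: "'m \<Rightarrow> 'a::{t2_space,second_countable_topology} set \<Rightarrow> ennreal"
  assumes lc: "locally_compact_space (euclidean :: 'a topology)" and M: "prob_space M"
    and X: "\<And>\<omega>. \<omega> \<in> space M \<Longrightarrow> sup_measure (X \<omega>)"
    and L: "\<And>f. f \<in> USC \<Longrightarrow> unit_frechet M (\<lambda>\<omega>. extremal_integral (X \<omega>) f) (L f)"
  shows "\<exists>(N :: ('a set \<Rightarrow> ennreal) measure) Z. tail_dependence_functional N Z L"
proof -
  interpret prob_space M by fact
  \<comment> \<open>With this sigma-algebra a function on \<open>sup_measures\<close> is measurable
    as soon as its composition with X is. The realising variable on the new space is the
    identity.\<close>
  define \<Sigma> where "\<Sigma> = {S. S \<subseteq> sup_measures \<and> X -` S \<inter> space M \<in> sets M}"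
  have Xin: "X \<omega> \<in> sup_measures" if "\<omega> \<in> space M" for \<omega> using X[OF that] by (simp add: sup_measures_def)
  have sa: "sigma_algebra sup_measures \<Sigma>"
  proof (rule sigma_algebra_iff2[THEN iffD2], intro conjI ballI allI impI)
    show "\<Sigma> \<subseteq> Pow sup_measures" "{} \<in> \<Sigma>" by (auto simp: \<Sigma>_def)
    fix S assume S: "S \<in> \<Sigma>"
    have "X -` (sup_measures - S) \<inter> space M = space M - (X -` S \<inter> space M)" using Xin by auto
    then show "sup_measures - S \<in> \<Sigma>" using S by (auto simp: \<Sigma>_def)
  next
    fix S :: "nat \<Rightarrow> _" assume S: "range S \<subseteq> \<Sigma>"
    have "X -` (\<Union>n. S n) \<inter> space M = (\<Union>n. X -` S n \<inter> space M)" by auto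
    also have "\<dots> \<in> sets M" using S by (intro sets.countable_UN) (auto simp: \<Sigma>_def)
    finally show "(\<Union>n. S n) \<in> \<Sigma>" using S by (auto simp: \<Sigma>_def)
  qed
  define N where "N = distr M (sigma sup_measures \<Sigma>) X"
  have sub: "\<Sigma> \<subseteq> Pow sup_measures" by (auto simp: \<Sigma>_def)
  have sets: "sets N = \<Sigma>" and space: "space N = sup_measures"
    using sigma_algebra.sigma_sets_eq[OF sa] sub by (simp_all add: N_def)
  have X_meas: "X \<in> M \<rightarrow>\<^sub>M sigma sup_measures \<Sigma>"
    by (rule measurable_measure_of[OF sub]) (use Xin in \<open>auto simp: \<Sigma>_def\<close>)
  have "unit_frechet N (\<lambda>\<phi>. extremal_integral \<phi> f) (L f)" if f: "f \<in> USC" for f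
  proof -
    note uf = L[OF f, unfolded unit_frechet_def]
    have "(\<lambda>\<phi>. extremal_integral \<phi> f) \<in> borel_measurable N"
    proof (rule measurableI)
      fix S assume S: "S \<in> sets (borel :: ennreal measure)"
      have "X -` ((\<lambda>\<phi>. extremal_integral \<phi> f) -` S \<inter> space N) \<inter> space M =
        (\<lambda>\<omega>. extremal_integral (X \<omega>) f) -` S \<inter> space M"
        using Xin by (auto simp: space)
      also have "\<dots> \<in> sets M" using uf S by (auto intro: measurable_sets)
      finally show "(\<lambda>\<phi>. extremal_integral \<phi> f) -` S \<inter> space N \<in> sets N"
        unfolding sets by (simp add: \<Sigma>_def space)
    qed simp
    moreover from this have "{\<phi>\<in>space N. extremal_integral \<phi> f \<le> ennreal t} \<in> sets N" for t
      by (intro borel_measurable_le) auto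
    then have "measure N {\<phi>\<in>space N. extremal_integral \<phi> f \<le> ennreal t} =
      measure M {\<omega>\<in>space M. extremal_integral (X \<omega>) f \<le> ennreal t}" for t
      unfolding N_def using X_meas Xin sub
      by (subst measure_distr) (auto intro!: arg_cong[where f = "measure M"])
    ultimately show ?thesis using uf by (simp add: unit_frechet_def)
  qed
  moreover have "prob_space N" unfolding N_def by (rule prob_space_distr[OF X_meas])
  ultimately have "tail_dependence_functional N (\<lambda>\<phi>. \<phi>) L"
    by (intro tail_dependence_functionalI[OF lc]) (auto simp: space sup_measures_def)
  then show ?thesis by blast
qed

section \<open>The random family of bounds\<close>

context relatively_compact_base begin

text \<open>The sample space is cut down to the points where W is consistent, so that the
  deterministic lemmas on boxes apply at every remaining point. The existence of a covering is then
  an increasing union of events about single finite sets of boxes.\<close>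

lemma ex_random_boxes:
  fixes L :: "('a \<Rightarrow> real) \<Rightarrow> real"
  assumes hom: "homogeneous_functional L" and mca: "max_completely_alternating L" and usc: "usc_functional L"
  obtains M :: "('a set \<times> real \<Rightarrow> real) measure" and W where "prob_space M"
    "\<And>\<omega>. W \<omega> \<subseteq> boxes"
    "\<And>\<omega> U. \<omega> \<in> space M \<Longrightarrow> U \<in> \<U> \<Longrightarrow> \<exists>q. (U, q) \<in> W \<omega>"
    "\<And>f. f \<in> USC \<Longrightarrow> {\<omega>\<in>space M. \<exists>B\<in>covering_sets f. B \<subseteq> W \<omega>} \<in> sets M"
    "\<And>f. f \<in> USC \<Longrightarrow> measure M {\<omega>\<in>space M. \<exists>B\<in>covering_sets f. B \<subseteq> W \<omega>} = exp (- L f)"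
proof -
  interpret alternating_set_function boxes "\<lambda>B. L (max_over box_fun B)"
    using hom mca box_fun_USC by (rule alternating_set_function_max_over)
  obtain M :: "('a set \<times> real \<Rightarrow> real) measure" and A where "prob_space M"
    and A: "\<And>p. p \<in> boxes \<Longrightarrow> A p \<in> sets M"
    and prob_A: "\<And>B. finite B \<Longrightarrow> B \<subseteq> boxes \<Longrightarrow> measure M {\<omega>\<in>space M. \<forall>p\<in>B. \<omega> \<in> A p} = exp (- L (max_over box_fun B))"
    by (rule ex_events) blast
  interpret prob_space M by fact
  define W where "W \<omega> = {p\<in>boxes. \<omega> \<in> A p}" for \<omega>
  have W_box: "W \<omega> \<subseteq> boxes" for \<omega> by (auto simp: W_def)
  have W_meas [measurable]: "Measurable.pred M (\<lambda>\<omega>. p \<in> W \<omega>)" for p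
  proof (cases "p \<in> boxes")
    case True
    then show ?thesis using A sets.sets_into_space
      by (auto simp: W_def pred_def Int_def[symmetric] Collect_conj_eq)
  qed (simp add: W_def)
  have prob_W: "prob {\<omega>\<in>space M. B \<subseteq> W \<omega>} = exp (- L (max_over box_fun B))" if "finite B" "B \<subseteq> boxes" for B
  proof -
    have "{\<omega>\<in>space M. B \<subseteq> W \<omega>} = {\<omega>\<in>space M. \<forall>p\<in>B. \<omega> \<in> A p}" using that by (auto simp: W_def)
    then show ?thesis using prob_A that by simp
  qed
  have W_sub_meas [measurable]: "Measurable.pred M (\<lambda>\<omega>. B \<subseteq> W \<omega>)" if "finite B" for B
    unfolding subset_eq using that by measurable
  have ev: "{\<omega>\<in>space M. B \<subseteq> W \<omega>} \<in> sets M" if "finite B" for B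
    using W_sub_meas[OF that] by (simp add: pred_def)
  \<comment> \<open>Adding the smaller box p to {p'} leaves the maximum of the box functions
    unchanged, hence also the probability; so p' is almost never present without p.\<close>
  have AE_down: "AE \<omega> in M. p' \<in> W \<omega> \<longrightarrow> p \<in> W \<omega>" if p: "p \<in> boxes" "p' \<in> boxes" "below_box p p'" for p p'
  proof -
    have "max_over box_fun {p, p'} = max_over box_fun {p'}"
      by (intro ext antisym refines_max_over_le) (use p in \<open>auto simp: refines_def below_box_def\<close>)
    then have "prob {\<omega>\<in>space M. {p, p'} \<subseteq> W \<omega>} = prob {\<omega>\<in>space M. {p'} \<subseteq> W \<omega>}"
      using prob_W[of "{p, p'}"] prob_W[of "{p'}"] p(1,2) by simp
    then have "prob ({\<omega>\<in>space M. {p'} \<subseteq> W \<omega>} - {\<omega>\<in>space M. {p, p'} \<subseteq> W \<omega>}) = 0"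
      using ev[of "{p'}"] ev[of "{p, p'}"] by (subst finite_measure_Diff) auto
    moreover have "{\<omega>\<in>space M. {p'} \<subseteq> W \<omega>} - {\<omega>\<in>space M. {p, p'} \<subseteq> W \<omega>} \<in> sets M"
      using ev by (intro sets.Diff) auto
    ultimately have "AE \<omega> in M. \<omega> \<notin> {\<omega>\<in>space M. {p'} \<subseteq> W \<omega>} - {\<omega>\<in>space M. {p, p'} \<subseteq> W \<omega>}"
      using prob_eq_0 by blast
    then show ?thesis using AE_space by eventually_elim auto
  qed
  have total_meas [measurable]: "Measurable.pred M (\<lambda>\<omega>. \<exists>q\<in>\<rat>. (U, q) \<in> W \<omega>)" for U
    using W_meas unfolding pred_def by (intro sets.sets_Collect_countable_Ex' countable_rat)
  \<comment> \<open>The bound \<open>1 / q\<close> gets weaker as q tends to 0: by homogeneity the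
    box (U, q) is present with probability exp (- q c), which tends to 1 along q = 1 / Suc
    n.\<close>
  have AE_total: "AE \<omega> in M. \<exists>q\<in>\<rat>. (U, q) \<in> W \<omega>" if U: "U \<in> \<U>" for U
  proof -
    define c where "c = L (indicator (closure U))"
    have "exp (- (1 / Suc n * c)) \<le> prob {\<omega>\<in>space M. \<exists>q\<in>\<rat>. (U, q) \<in> W \<omega>}" for n
    proof -
      define q :: real where "q = 1 / Suc n"
      have q: "q \<in> \<rat>" "0 < q" unfolding q_def by auto
      have "max_over box_fun {(U, q)} = (\<lambda>x. q * indicator (closure U) x)"
        using q by (auto simp: max_over_def box_fun_def fun_eq_iff)
      moreover have "L (\<lambda>x. q * indicator (closure U) x) = q * c"
        unfolding c_def using q USC_indicator[OF \<U>_compact[OF U] zero_le_one]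
        by (intro hom[unfolded homogeneous_functional_def, rule_format]) simp_all
      ultimately have "exp (- (q * c)) = prob {\<omega>\<in>space M. {(U, q)} \<subseteq> W \<omega>}"
        using prob_W[of "{(U, q)}"] U q by (simp add: boxes_def)
      also have "\<dots> \<le> prob {\<omega>\<in>space M. \<exists>q\<in>\<rat>. (U, q) \<in> W \<omega>}"
        using q total_meas by (intro finite_measure_mono) (auto simp: pred_def)
      finally show ?thesis by (simp add: q_def)
    qed
    moreover have "(\<lambda>n. exp (- (1 / Suc n * c))) \<longlonglongrightarrow> exp (- (0 * c))"
      by (intro tendsto_exp tendsto_minus tendsto_mult tendsto_const LIMSEQ_Suc[OF lim_1_over_n])
    ultimately have "1 \<le> prob {\<omega>\<in>space M. \<exists>q\<in>\<rat>. (U, q) \<in> W \<omega>}"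
      by (intro LIMSEQ_le_const2) auto
    then have "prob {\<omega>\<in>space M. \<exists>q\<in>\<rat>. (U, q) \<in> W \<omega>} = 1" by (simp add: antisym)
    then show ?thesis using total_meas by (subst (asm) prob_Collect_eq_1) (auto simp: pred_def)
  qed
  \<comment> \<open>Both requirements range over countable families, so almost surely they hold
    simultaneously.\<close>
  define good where "good \<omega> \<longleftrightarrow> (\<forall>p\<in>boxes. \<forall>p'\<in>boxes. below_box p p' \<longrightarrow> p' \<in> W \<omega> \<longrightarrow> p \<in> W \<omega>) \<and>
    (\<forall>U\<in>\<U>. \<exists>q\<in>\<rat>. (U, q) \<in> W \<omega>)" for \<omega>
  have good_meas [measurable]: "Measurable.pred M good"
    using W_meas total_meas unfolding good_def pred_def
    by (intro sets.sets_Collect_conj sets.sets_Collect_countable_All' sets.sets_Collect_imp sets.sets_Collect_const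
        countable_boxes \<U>_countable)
  have AE_good: "AE \<omega> in M. good \<omega>"
    unfolding good_def using countable_boxes \<U>_countable AE_down AE_total
    by (auto simp: AE_ball_countable)
  define N where "N = restrict_space M {\<omega>\<in>space M. good \<omega>}"
  have good_sets: "{\<omega>\<in>space M. good \<omega>} \<in> sets M" by measurable
  have space_N: "space N = {\<omega>\<in>space M. good \<omega>}" by (auto simp: N_def space_restrict_space)
  have sets_N: "S \<in> sets N" if "S \<in> sets M" "S \<subseteq> {\<omega>\<in>space M. good \<omega>}" for S
    using that good_sets by (auto simp: N_def sets_restrict_space_iff)
  have measure_N: "measure N S = prob S" if "S \<subseteq> {\<omega>\<in>space M. good \<omega>}" for S
    unfolding N_def using that good_sets by (intro measure_restrict_space) auto
  have "prob {\<omega>\<in>space M. good \<omega>} = 1" using AE_good by (subst prob_Collect_eq_1) auto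
  then have prob_N: "prob_space N"
    unfolding N_def using good_sets
      by (intro prob_spaceI) (simp add: emeasure_restrict_space space_restrict_space emeasure_eq_measure Int_absorb2)
  have main: "{\<omega>\<in>space N. \<exists>B\<in>covering_sets f. B \<subseteq> W \<omega>} \<in> sets N \<and>
    measure N {\<omega>\<in>space N. \<exists>B\<in>covering_sets f. B \<subseteq> W \<omega>} = exp (- L f)" if f: "f \<in> USC" for f
  proof -
    obtain b where b: "\<And>n. b n \<in> covering_sets f" "\<And>n. refines (b (Suc n)) (b n)"
      "\<And>B. B \<in> covering_sets f \<Longrightarrow> \<exists>n. refines (b n) B"
      "(\<lambda>n. L (max_over box_fun (b n))) \<longlonglongrightarrow> L f"
      using ex_covering_sequence[OF usc f] by blast
    have fin: "finite (b n)" "b n \<subseteq> boxes" for n using b(1)[of n] by (auto simp: covering_sets_def)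
    define S where "S n = {\<omega>\<in>space M. good \<omega> \<and> b n \<subseteq> W \<omega>}" for n
    \<comment> \<open>At a good point, a family W that contains B contains every \<open>b n\<close>
      refining B. By cofinality an arbitrary covering can thus be exchanged for some
      \<open>b n\<close>.\<close>
    have down: "b n \<subseteq> W \<omega>" if H: "good \<omega>" "refines (b n) B" "B \<subseteq> W \<omega>" for n B \<omega>
    proof
      fix p assume p: "p \<in> b n"
      then obtain p' where "p' \<in> B" "below_box p p'" using H(2) by (auto simp: refines_def)
      then show "p \<in> W \<omega>" using H(1,3) p fin(2) W_box unfolding good_def by blast
    qed
    have S_sets: "S n \<in> sets M" for n
    proof -
      have [measurable]: "Measurable.pred M (\<lambda>\<omega>. b n \<subseteq> W \<omega>)" by (rule W_sub_meas[OF fin(1)])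
      show ?thesis unfolding S_def by measurable
    qed
    have eq: "{\<omega>\<in>space N. \<exists>B\<in>covering_sets f. B \<subseteq> W \<omega>} = (\<Union>n. S n)"
    proof (intro subset_antisym subsetI)
      fix \<omega> assume "\<omega> \<in> {\<omega>\<in>space N. \<exists>B\<in>covering_sets f. B \<subseteq> W \<omega>}"
      then obtain B where \<omega>: "\<omega> \<in> space M" "good \<omega>" "B \<subseteq> W \<omega>" and B: "B \<in> covering_sets f"
        by (auto simp: space_N)
      obtain n where "refines (b n) B" using b(3)[OF B] by blast
      then have "\<omega> \<in> S n" using \<omega> down[of \<omega> n B] by (simp add: S_def)
      then show "\<omega> \<in> (\<Union>n. S n)" by blast
    next
      fix \<omega> assume "\<omega> \<in> (\<Union>n. S n)"
      then obtain n where "\<omega> \<in> S n" by blast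
      then show "\<omega> \<in> {\<omega>\<in>space N. \<exists>B\<in>covering_sets f. B \<subseteq> W \<omega>}"
        using b(1)[of n] by (auto simp: space_N S_def)
    qed
    have "incseq S" unfolding S_def using down[OF _ b(2)] by (intro incseq_SucI subsetI) simp
    then have "(\<lambda>n. prob (S n)) \<longlonglongrightarrow> prob (\<Union>n. S n)"
      using S_sets by (intro finite_Lim_measure_incseq) auto
    moreover have "prob (S n) = exp (- L (max_over box_fun (b n)))" for n
    proof -
      have "prob (S n) = prob {\<omega>\<in>space M. b n \<subseteq> W \<omega>}"
        using S_sets W_sub_meas[OF fin(1)] AE_good by (intro finite_measure_eq_AE) (auto simp: S_def pred_def)
      then show ?thesis using prob_W[OF fin] by simp
    qed
    ultimately have "prob (\<Union>n. S n) = exp (- L f)"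
      using tendsto_exp[OF tendsto_minus[OF b(4)]] by (simp add: LIMSEQ_unique)
    moreover have "(\<Union>n. S n) \<subseteq> {\<omega>\<in>space M. good \<omega>}" by (auto simp: S_def)
    moreover have "(\<Union>n. S n) \<in> sets M" using S_sets by auto
    ultimately show ?thesis unfolding eq by (simp add: sets_N measure_N)
  qed
  show thesis
  proof (rule that[of N W])
    show "\<exists>q. (U, q) \<in> W \<omega>" if "\<omega> \<in> space N" "U \<in> \<U>" for \<omega> U
      using that unfolding space_N good_def by blast
  qed (use prob_N main in \<open>auto simp: W_def\<close>)
qed

end

lemma ex_tail_dependence_functional:
  fixes L :: "('a::{t2_space,second_countable_topology} \<Rightarrow> real) \<Rightarrow> real"
  assumes lc: "locally_compact_space (euclidean :: 'a topology)"
    and nonneg: "\<And>f. f \<in> USC \<Longrightarrow> 0 \<le> L f"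
    and hom: "homogeneous_functional L" and mca: "max_completely_alternating L" and usc: "usc_functional L"
  shows "\<exists>(M :: ('a set \<Rightarrow> ennreal) measure) X. tail_dependence_functional M X L"
proof -
  obtain \<U> :: "'a set set" where "relatively_compact_base \<U>"
    by (rule relatively_compact_basis[OF lc], rule that, rule relatively_compact_base.intro)
  then interpret relatively_compact_base \<U> .
  obtain M :: "('a set \<times> real \<Rightarrow> real) measure" and W where M: "prob_space M" and W: "\<And>\<omega>. W \<omega> \<subseteq> boxes"
    "\<And>\<omega> U. \<omega> \<in> space M \<Longrightarrow> U \<in> \<U> \<Longrightarrow> \<exists>q. (U, q) \<in> W \<omega>"
    and C: "\<And>f. f \<in> USC \<Longrightarrow> {\<omega>\<in>space M. \<exists>B\<in>covering_sets f. B \<subseteq> W \<omega>} \<in> sets M"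
    "\<And>f. f \<in> USC \<Longrightarrow> measure M {\<omega>\<in>space M. \<exists>B\<in>covering_sets f. B \<subseteq> W \<omega>} = exp (- L f)"
    by (rule ex_random_boxes[OF hom mca usc]) blast
  define X where "X \<omega> = box_measure (W \<omega>)" for \<omega>
  have X: "sup_measure (X \<omega>)" if "\<omega> \<in> space M" for \<omega>
    unfolding X_def by (rule sup_measure_box_measure[OF W(1) W(2)[OF that]])
  have "unit_frechet M (\<lambda>\<omega>. extremal_integral (X \<omega>) f) (L f)" if f: "f \<in> USC" for f
  proof (rule unit_frechetI_sandwich[OF M nonneg[OF f]])
    fix t :: real assume t: "0 < t"
    \<comment> \<open>Rescaling moves level t to level 1, at which the boxes are calibrated;
      homogeneity of L puts 1 / t into the exponent.\<close>
    define g where "g = (\<lambda>x. 1 / t * f x)"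
    have g: "g \<in> USC" unfolding g_def using t by (intro USC_mult_left[OF f]) simp
    have Lg: "L g = L f / t"
      unfolding g_def using hom[unfolded homogeneous_functional_def, rule_format, OF _ f, of "1 / t"] t by simp
    have int: "extremal_integral (X \<omega>) f = ennreal t * extremal_integral (X \<omega>) g" if "\<omega> \<in> space M" for \<omega>
    proof -
      have "extremal_integral (X \<omega>) (\<lambda>x. t * g x) = ennreal t * extremal_integral (X \<omega>) g"
        using t by (intro extremal_integral_mult_left[OF lc X[OF that]] USC_nonneg[OF g]) simp
      then show ?thesis using t by (simp add: g_def)
    qed
    let ?D = "{\<omega>\<in>space M. \<exists>B\<in>covering_sets (\<lambda>x. 1 / t * f x). B \<subseteq> W \<omega>}"
    show "?D \<in> sets M" "measure M ?D = exp (- L f / t)"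
      using C[OF g] Lg by (simp_all add: g_def)
    show "\<omega> \<in> ?D" if \<omega>: "\<omega> \<in> space M" and less: "extremal_integral (X \<omega>) f < ennreal t" for \<omega>
    proof -
      have "\<not> 1 \<le> extremal_integral (X \<omega>) g"
      proof
        assume "1 \<le> extremal_integral (X \<omega>) g"
        then have "ennreal t * 1 \<le> ennreal t * extremal_integral (X \<omega>) g" by (rule mult_left_mono) simp
        then show False using less int[OF \<omega>] by simp
      qed
      then have "\<exists>B\<in>covering_sets g. B \<subseteq> W \<omega>"
        using extremal_integral_less_imp_covers[OF W(1) W(2)[OF \<omega>] g] by (simp add: X_def not_le)
      then show ?thesis using \<omega> by (simp add: g_def)
    qed
    show "extremal_integral (X \<omega>) f \<le> ennreal t" if \<omega>: "\<omega> \<in> ?D" for \<omega>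
    proof -
      have \<omega>': "\<omega> \<in> space M" using \<omega> by simp
      obtain B where "B \<subseteq> W \<omega>" "covers B g" using \<omega> by (auto simp: covering_sets_def g_def)
      then have "extremal_integral (X \<omega>) g \<le> 1"
        unfolding X_def using covers_imp_extremal_integral_le[OF W(1) W(2)[OF \<omega>'] _ _ g] by blast
      then have "ennreal t * extremal_integral (X \<omega>) g \<le> ennreal t * 1" by (rule mult_left_mono) simp
      then show ?thesis using int[OF \<omega>'] by simp
    qed
  qed
  then show ?thesis by (intro tail_dependence_functional_transport[where X = X, OF lc M X])
qed

section \<open>Necessity and uniqueness\<close>

lemma max_diff_cong:
  fixes f :: "'a::t2_space \<Rightarrow> real"
  assumes "\<And>f. f \<in> USC \<Longrightarrow> L f = L' f" "f \<in> USC" "set gs \<subseteq> USC"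
  shows "max_diff L gs f = max_diff L' gs f"
  using assms(2,3)
proof (induction gs arbitrary: f)
  case (Cons g gs)
  then show ?case using USC_max[of f g] by simp
qed (simp add: assms(1))

text \<open>Differences annihilate constants, so the 1 survives only when no difference is
  taken.\<close>

lemma max_diff_affine:
  "max_diff (\<lambda>f. c * (1 - L f)) gs f = c * ((if gs = [] then 1 else 0) - max_diff L gs f)"
  by (induction gs arbitrary: f) (auto simp: algebra_simps)

lemma tendsto_max_diff:
  fixes f :: "'a::t2_space \<Rightarrow> real"
  assumes "\<And>f. f \<in> USC \<Longrightarrow> ((\<lambda>n. L n f) \<longlongrightarrow> L' f) F" "f \<in> USC" "set gs \<subseteq> USC"
  shows "((\<lambda>n. max_diff (L n) gs f) \<longlongrightarrow> max_diff L' gs f) F"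
  using assms(2,3)
proof (induction gs arbitrary: f)
  case (Cons g gs)
  then show ?case using USC_max[of f g] by (auto intro: tendsto_diff)
qed (simp add: assms(1))

text \<open>A difference quotient of \<open>exp (- a * x)\<close> at 0 with step 1 / Suc n.\<close>

lemma tendsto_scaled_one_minus_exp:
  fixes a :: real
  shows "(\<lambda>n. real (Suc n) * (1 - exp (- a / real (Suc n)))) \<longlonglongrightarrow> a"
proof -
  have "((\<lambda>x. exp (- a * x)) has_field_derivative - a) (at 0)"
    by (auto intro!: derivative_eq_intros)
  then have "((\<lambda>h. (exp (- a * h) - 1) / h) \<longlongrightarrow> - a) (at 0)"
    by (simp add: has_field_derivative_iff)
  moreover have "filterlim (\<lambda>n. 1 / real (Suc n)) (at 0) sequentially"
    using LIMSEQ_Suc[OF lim_1_over_n[where 'a = real]] by (intro filterlim_atI) auto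
  ultimately have "(\<lambda>n. (exp (- a * (1 / real (Suc n))) - 1) / (1 / real (Suc n))) \<longlonglongrightarrow> - a"
    by (rule filterlim_compose)
  from tendsto_minus[OF this] show ?thesis by (simp add: algebra_simps)
qed

lemma ennreal_mult_le_1_iff:
  assumes "0 < c"
  shows "ennreal c * y \<le> 1 \<longleftrightarrow> y \<le> ennreal (1 / c)"
  using assms
    by (cases y) (auto simp: ennreal_mult[symmetric] ennreal_mult_top field_simps ennreal_le_1 top_unique)

text \<open>By continuity of multiplication there is a common slack e > 0 with (r + e) (f x + e) <
  1, and semicontinuity keeps both factors below these values near x. Adding the slack to each
  factor also covers the case where one of them is 0.\<close>

lemma open_mult_less_one:
  fixes d :: "'a::topological_space \<Rightarrow> ennreal" and f :: "'a \<Rightarrow> real"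
  assumes d: "\<And>t. open {x. d x < t}" "\<And>x. d x < \<infinity>" and f: "\<And>x. 0 \<le> f x" "\<And>t. open {x. f x < t}"
  shows "open {x. d x * ennreal (f x) < 1}"
proof (subst open_subopen, clarify)
  fix x assume x: "d x * ennreal (f x) < 1"
  obtain r where r: "d x = ennreal r" "0 \<le> r" using d(2)[of x] by (cases "d x") auto
  have "r * f x < 1" using x f(1)[of x] r by (simp add: ennreal_mult[symmetric] ennreal_less_iff)
  moreover have "((\<lambda>e. (r + e) * (f x + e)) \<longlongrightarrow> (r + 0) * (f x + 0)) (at_right 0)"
    by (intro tendsto_intros)
  ultimately have "eventually (\<lambda>e. (r + e) * (f x + e) < 1) (at_right 0)"
    by (intro order_tendstoD(2)) auto
  then have "eventually (\<lambda>e. 0 < e \<and> (r + e) * (f x + e) < 1) (at_right 0)"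
    using eventually_at_right_less by eventually_elim auto
  then have "\<exists>e. 0 < e \<and> (r + e) * (f x + e) < 1" by (rule eventually_happens'[rotated]) simp
  then obtain e where e: "0 < e" "(r + e) * (f x + e) < 1" by blast
  let ?T = "{y. d y < ennreal (r + e)} \<inter> {y. f y < f x + e}"
  have "?T \<subseteq> {x. d x * ennreal (f x) < 1}"
  proof
    fix y assume y: "y \<in> ?T"
    then have "d y * ennreal (f y) \<le> ennreal (r + e) * ennreal (f x + e)"
      by (intro mult_mono ennreal_leI) auto
    also have "\<dots> = ennreal ((r + e) * (f x + e))"
      using e r f(1)[of x] by (intro ennreal_mult[symmetric]) auto
    also have "\<dots> < 1" using e r f(1)[of x] by (simp add: ennreal_less_iff)
    finally show "y \<in> {x. d x * ennreal (f x) < 1}" by simp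
  qed
  moreover have "open ?T" using d f by (intro open_Int)
  moreover have "x \<in> ?T" using r e by (auto simp: ennreal_less_iff)
  ultimately show "\<exists>T. open T \<and> x \<in> T \<and> T \<subseteq> {x. d x * ennreal (f x) < 1}" by blast
qed

section \<open>Extremal integrals as functions of the integrand\<close>

context
  fixes \<phi> :: "'a::{t2_space,second_countable_topology} set \<Rightarrow> ennreal"
  assumes lc: "locally_compact_space (euclidean :: 'a topology)" and \<phi>: "sup_measure \<phi>"
begin

lemma extremal_integral_le_iff:
  "f \<in> USC \<Longrightarrow> extremal_integral \<phi> f \<le> c \<longleftrightarrow> (\<forall>x. \<phi> {x} * ennreal (f x) \<le> c)"
  by (simp add: extremal_integral_eq_SUP[OF lc \<phi>] USC_nonneg SUP_le_iff)

text \<open>Under an upper bound on the integral a maximum becomes a conjunction, which is what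
  makes inclusion-exclusion available.\<close>

lemma extremal_integral_max_le_iff:
  assumes "f \<in> USC" "g \<in> USC"
  shows "extremal_integral \<phi> (\<lambda>x. max (f x) (g x)) \<le> c \<longleftrightarrow> extremal_integral \<phi> f \<le> c \<and> extremal_integral \<phi> g \<le> c"
proof -
  have "\<phi> {x} * ennreal (max (f x) (g x)) \<le> c \<longleftrightarrow> \<phi> {x} * ennreal (f x) \<le> c \<and> \<phi> {x} * ennreal (g x) \<le> c" for x
  proof -
    have "ennreal (max (f x) (g x)) = max (ennreal (f x)) (ennreal (g x))"
      by (auto simp: max_def ennreal_leI intro: antisym)
    then have "\<phi> {x} * ennreal (max (f x) (g x)) = max (\<phi> {x} * ennreal (f x)) (\<phi> {x} * ennreal (g x))"
      by (auto simp: max_def mult_left_mono intro: antisym)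
    then show ?thesis by simp
  qed
  then show ?thesis
    unfolding extremal_integral_le_iff[OF assms(1)] extremal_integral_le_iff[OF assms(2)]
      extremal_integral_le_iff[OF USC_max[OF assms]] by auto
qed

lemma extremal_integral_mono:
  assumes "f \<in> USC" "g \<in> USC" "\<And>x. f x \<le> g x"
  shows "extremal_integral \<phi> f \<le> extremal_integral \<phi> g"
  unfolding extremal_integral_le_iff[OF assms(1)]
proof
  fix x
  have "\<phi> {x} * ennreal (f x) \<le> \<phi> {x} * ennreal (g x)" using assms(3) by (intro mult_left_mono ennreal_leI) auto
  also have "\<dots> \<le> extremal_integral \<phi> g" using extremal_integral_le_iff[OF assms(2)] by blast
  finally show "\<phi> {x} * ennreal (f x) \<le> extremal_integral \<phi> g" .
qed

text \<open>A Dini argument: the products of the density with \<open>fn n\<close> are upper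
  semicontinuous and decrease, so the open sets where they are below 1 increase to the whole space.
  Finitely many of them cover the compact support of \<open>fn 0\<close>, outside of which every
  \<open>fn n\<close> vanishes.\<close>

lemma ex_extremal_integral_le_one:
  assumes fn: "\<And>n. fn n \<in> USC" and f: "f \<in> USC" and dec: "\<And>x. decseq (\<lambda>n. fn n x)"
    and lim: "\<And>x. (\<lambda>n. fn n x) \<longlonglongrightarrow> f x" and less: "extremal_integral \<phi> f < 1"
  shows "\<exists>n. extremal_integral \<phi> (fn n) \<le> 1"
proof -
  let ?T = "\<lambda>n. {x. \<phi> {x} * ennreal (fn n x) < 1}"
  have fin: "\<phi> {x} < \<infinity>" for x using \<phi> by (auto simp: sup_measure_def)
  have op: "open (?T n)" for n
    by (intro open_mult_less_one open_sup_measure_less[OF lc \<phi>] fin USC_nonneg[OF fn] USC_open_less[OF fn])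
  have "\<exists>n. x \<in> ?T n" for x
  proof -
    have "\<phi> {x} * ennreal (f x) < 1"
      using less extremal_integral_le_iff[OF f, of "extremal_integral \<phi> f"] by (auto intro: le_less_trans)
    moreover have "(\<lambda>n. \<phi> {x} * ennreal (fn n x)) \<longlonglongrightarrow> \<phi> {x} * ennreal (f x)"
      using fin[of x] by (intro ennreal_tendsto_cmult tendsto_ennrealI lim) auto
    ultimately have "eventually (\<lambda>n. \<phi> {x} * ennreal (fn n x) < 1) sequentially"
      by (rule order_tendstoD(2)[rotated])
    then show ?thesis by (auto simp: eventually_sequentially)
  qed
  then have "closure {x. fn 0 x \<noteq> 0} \<subseteq> (\<Union>n\<in>UNIV. ?T n)" by blast
  then obtain S where S: "finite S" "closure {x. fn 0 x \<noteq> 0} \<subseteq> (\<Union>n\<in>S. ?T n)"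
    by (rule compactE_image[OF USC_compact_support[OF fn] op])
  define N where "N = Max (insert 0 S)"
  have mono: "fn N x \<le> fn n x" if "n \<in> insert 0 S" for n x
    using that S(1) by (intro decseqD[OF dec]) (simp add: N_def)
  have "\<phi> {x} * ennreal (fn N x) \<le> 1" for x
  proof (cases "fn 0 x = 0")
    case True
    then have "fn N x = 0" using mono[of 0 x] USC_nonneg[OF fn, of N x] by simp
    then show ?thesis by simp
  next
    case False
    then have "x \<in> closure {x. fn 0 x \<noteq> 0}" using closure_subset[of "{x. fn 0 x \<noteq> 0}"] by auto
    then obtain n where n: "n \<in> S" "\<phi> {x} * ennreal (fn n x) < 1" using S(2) by auto
    have "\<phi> {x} * ennreal (fn N x) \<le> \<phi> {x} * ennreal (fn n x)"
      using mono n(1) by (intro mult_left_mono ennreal_leI) auto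
    then show ?thesis using n(2) by simp
  qed
  then show ?thesis using extremal_integral_le_iff[OF fn] by blast
qed

end

section \<open>Properties of the tail dependence functional\<close>

context
  fixes M :: "'m measure" and X :: "'m \<Rightarrow> 'a::{t2_space,second_countable_topology} set \<Rightarrow> ennreal" and L
  assumes lc: "locally_compact_space (euclidean :: 'a topology)" and tdf: "tail_dependence_functional M X L"
begin

lemma prob_space_tail_dependence: "prob_space M"
  and measurable_tail_dependence: "X \<in> M \<rightarrow>\<^sub>M borel_of_top sup_vague_topology"
  using tdf by (auto simp: tail_dependence_functional_def max_stable_def random_sup_measure_def)

interpretation prob_space M by (rule prob_space_tail_dependence)

lemma sup_measure_tail_dependence: "\<omega> \<in> space M \<Longrightarrow> sup_measure (X \<omega>)"
  using measurable_space[OF measurable_tail_dependence] by (auto simp: space_borel_sup_vague sup_measures_def)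

lemma extremal_event:
  assumes "f \<in> USC"
  shows "{\<omega>\<in>space M. extremal_integral (X \<omega>) f \<le> c} \<in> sets M"
proof -
  have "(\<lambda>\<omega>. extremal_integral (X \<omega>) f) \<in> borel_measurable M"
    using tdf assms by (auto simp: tail_dependence_functional_def unit_frechet_def)
  then show ?thesis by measurable
qed

lemma prob_extremal_le:
  assumes "f \<in> USC" "0 < t"
  shows "prob {\<omega>\<in>space M. extremal_integral (X \<omega>) f \<le> ennreal t} = exp (- L f / t)"
  using tdf assms by (auto simp: tail_dependence_functional_def unit_frechet_def)

lemma prob_extremal_le_one:
  assumes "f \<in> USC"
  shows "prob {\<omega>\<in>space M. extremal_integral (X \<omega>) f \<le> 1} = exp (- L f)"
  using prob_extremal_le[OF assms, of 1] by simp

lemma tail_dependence_homogeneous: "homogeneous_functional L"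
  unfolding homogeneous_functional_def
proof (intro allI impI ballI)
  fix c :: real and f :: "'a \<Rightarrow> real" assume c: "0 < c" and f: "f \<in> USC"
  have "extremal_integral (X \<omega>) (\<lambda>x. c * f x) = ennreal c * extremal_integral (X \<omega>) f" if "\<omega> \<in> space M" for \<omega>
    using c USC_nonneg[OF f]
      by (intro extremal_integral_mult_left[OF lc sup_measure_tail_dependence[OF that]]) auto
  then have "{\<omega>\<in>space M. extremal_integral (X \<omega>) (\<lambda>x. c * f x) \<le> 1} = {\<omega>\<in>space M. extremal_integral (X \<omega>) f \<le> ennreal (1 / c)}"
    using ennreal_mult_le_1_iff[OF c] by auto
  then have "exp (- L (\<lambda>x. c * f x)) = exp (- L f / (1 / c))"
    using prob_extremal_le_one[OF USC_mult_left[OF f c]] prob_extremal_le[OF f, of "1 / c"] c by simp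
  then show "L (\<lambda>x. c * f x) = c * L f" by simp
qed

text \<open>By \<open>extremal_integral_max_le_iff\<close> each difference removes the event that g
  satisfies the bound as well. An iterated difference of probabilities is therefore a probability,
  in particular nonnegative.\<close>

lemma max_diff_prob:
  assumes "f \<in> USC" "set gs \<subseteq> USC"
  shows "max_diff (\<lambda>f. prob {\<omega>\<in>space M. extremal_integral (X \<omega>) f \<le> c}) gs f =
    prob {\<omega>\<in>space M. extremal_integral (X \<omega>) f \<le> c \<and> (\<forall>g\<in>set gs. \<not> extremal_integral (X \<omega>) g \<le> c)}"
  using assms
proof (induction gs arbitrary: f)
  case (Cons g gs)
  let ?S = "\<lambda>f gs. {\<omega>\<in>space M. extremal_integral (X \<omega>) f \<le> c \<and> (\<forall>g\<in>set gs. \<not> extremal_integral (X \<omega>) g \<le> c)}"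
  have S: "?S f gs \<in> sets M" if "f \<in> USC" "set gs \<subseteq> USC" for f gs
    using that extremal_event
    by (intro sets.sets_Collect_conj sets.sets_Collect_countable_All' sets.sets_Collect_neg) (auto intro: countable_finite)
  have g: "g \<in> USC" "set gs \<subseteq> USC" using Cons.prems by auto
  have "?S (\<lambda>x. max (f x) (g x)) gs \<subseteq> ?S f gs" "?S f (g # gs) = ?S f gs - ?S (\<lambda>x. max (f x) (g x)) gs"
    using extremal_integral_max_le_iff[OF lc sup_measure_tail_dependence Cons.prems(1) g(1)] by auto
  then have "prob (?S f (g # gs)) = prob (?S f gs) - prob (?S (\<lambda>x. max (f x) (g x)) gs)"
    using finite_measure_Diff[OF S[OF Cons.prems(1) g(2)] S[OF USC_max[OF Cons.prems(1) g(1)] g(2)]] by simp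
  then show ?case using Cons.IH[OF Cons.prems(1) g(2)] Cons.IH[OF USC_max[OF Cons.prems(1) g(1)] g(2)] by simp
qed simp

lemma tail_dependence_max_completely_alternating: "max_completely_alternating L"
  unfolding max_completely_alternating_def
proof (intro allI impI, elim conjE)
  fix f :: "'a \<Rightarrow> real" and gs :: "('a \<Rightarrow> real) list" assume f: "f \<in> USC" and gs: "gs \<noteq> []" "set gs \<subseteq> USC"
  \<comment> \<open>Since gs is nonempty the constant drops out, and -t times a probability
    remains.\<close>
  have "max_diff (\<lambda>f. t * (1 - exp (- L f / t))) gs f \<le> 0" if t: "0 < t" for t
  proof -
    have "max_diff (\<lambda>f. exp (- L f / t)) gs f = max_diff (\<lambda>f. prob {\<omega>\<in>space M. extremal_integral (X \<omega>) f \<le> ennreal t}) gs f"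
      using prob_extremal_le t by (intro max_diff_cong f gs) simp
    then have "0 \<le> max_diff (\<lambda>f. exp (- L f / t)) gs f" using max_diff_prob[OF f gs(2)] by simp
    then show ?thesis using t gs(1) by (simp add: max_diff_affine)
  qed
  then have "max_diff (\<lambda>f. real (Suc n) * (1 - exp (- L f / real (Suc n)))) gs f \<le> 0" for n by simp
  moreover have "(\<lambda>n. max_diff (\<lambda>f. real (Suc n) * (1 - exp (- L f / real (Suc n)))) gs f) \<longlonglongrightarrow> max_diff L gs f"
    by (intro tendsto_max_diff f gs tendsto_scaled_one_minus_exp)
  ultimately show "max_diff L gs f \<le> 0" by (intro LIMSEQ_le_const2) auto
qed

lemma tail_dependence_usc: "usc_functional L"
  unfolding usc_functional_def
proof (intro allI impI, elim conjE)
  fix fn :: "nat \<Rightarrow> 'a \<Rightarrow> real" and f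
  assume "\<forall>n. fn n \<in> USC" and f: "f \<in> USC" and "\<forall>x. decseq (\<lambda>n. fn n x)" "\<forall>x. (\<lambda>n. fn n x) \<longlonglongrightarrow> f x"
  then have fn: "fn n \<in> USC" and dec: "decseq (\<lambda>n. fn n x)" and lim: "(\<lambda>n. fn n x) \<longlonglongrightarrow> f x" for n x by auto
  have mono: "L g \<le> L h" if "g \<in> USC" "h \<in> USC" "\<And>x. g x \<le> h x" for g h
    by (rule max_completely_alternating_mono[OF tail_dependence_max_completely_alternating that])
  have decL: "decseq (\<lambda>n. L (fn n))"
    using dec by (intro decseq_SucI mono fn) (simp add: decseq_Suc_iff)
  have le: "L f \<le> L (fn n)" for n using decseq_ge[OF dec lim] by (intro mono fn f)
  obtain l where l: "(\<lambda>n. L (fn n)) \<longlonglongrightarrow> l"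
    using decseq_convergent[OF decL, of "L f"] le by blast
  \<comment> \<open>The Dini argument starts from a strict inequality, so f is tested at a level s <
    1. The events for \<open>fn n\<close> increase to an event of probability exp (- l) that
    contains the event for f at level s. Comparing probabilities bounds l, and afterwards s tends to
    1.\<close>
  have "l \<le> L f / s" if s: "0 < s" "s < 1" for s
  proof -
    let ?S = "\<lambda>n. {\<omega>\<in>space M. extremal_integral (X \<omega>) (fn n) \<le> 1}"
    have "incseq ?S"
    proof (intro incseq_SucI subsetI)
      fix n \<omega> assume \<omega>: "\<omega> \<in> ?S n"
      have "extremal_integral (X \<omega>) (fn (Suc n)) \<le> extremal_integral (X \<omega>) (fn n)"
        using dec \<omega>
          by (intro extremal_integral_mono[OF lc] sup_measure_tail_dependence fn) (auto simp: decseq_Suc_iff)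
      then show "\<omega> \<in> ?S (Suc n)" using \<omega> by auto
    qed
    then have "(\<lambda>n. prob (?S n)) \<longlonglongrightarrow> prob (\<Union>n. ?S n)"
      using extremal_event[OF fn] by (intro finite_Lim_measure_incseq) auto
    then have "(\<lambda>n. exp (- L (fn n))) \<longlonglongrightarrow> prob (\<Union>n. ?S n)" by (simp add: prob_extremal_le_one[OF fn])
    then have "prob (\<Union>n. ?S n) = exp (- l)"
      by (rule LIMSEQ_unique) (intro tendsto_exp tendsto_minus l)
    moreover have "{\<omega>\<in>space M. extremal_integral (X \<omega>) f \<le> ennreal s} \<subseteq> (\<Union>n. ?S n)"
    proof
      fix \<omega> assume \<omega>: "\<omega> \<in> {\<omega>\<in>space M. extremal_integral (X \<omega>) f \<le> ennreal s}"
      have "ennreal s < 1" using s by (simp add: ennreal_less_iff flip: ennreal_1)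
      then have "extremal_integral (X \<omega>) f < 1" using \<omega> by (auto intro: le_less_trans)
      then have "\<exists>n. extremal_integral (X \<omega>) (fn n) \<le> 1"
        using \<omega> by (intro ex_extremal_integral_le_one[OF lc sup_measure_tail_dependence fn f dec lim]) auto
      then show "\<omega> \<in> (\<Union>n. ?S n)" using \<omega> by auto
    qed
    ultimately have "exp (- L f / s) \<le> exp (- l)"
      using prob_extremal_le[OF f s(1)] extremal_event[OF fn] finite_measure_mono[of "{\<omega>\<in>space M. extremal_integral (X \<omega>) f \<le> ennreal s}" "\<Union>n. ?S n"]
      by auto
    then show ?thesis by simp
  qed
  moreover have "((\<lambda>s. L f / s) \<longlongrightarrow> L f / 1) (at_left 1)" by (intro tendsto_intros) auto
  ultimately have "l \<le> L f / 1"
    using eventually_at_left_field[of "\<lambda>s. l \<le> L f / s" 1]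
    by (intro tendsto_lowerbound[of _ _ "at_left 1"]) (auto intro!: exI[of _ 0])
  moreover have "L f \<le> l" using le by (intro LIMSEQ_le_const[OF l]) auto
  ultimately have "l = L f" by simp
  then show "decseq (\<lambda>n. L (fn n)) \<and> (\<lambda>n. L (fn n)) \<longlonglongrightarrow> L f" using decL l by simp
qed

text \<open>Weights 1 / t turn the bounds on the values at K into one bound by 1 on the integral of
  a single USC function. Hence the finite-dimensional laws are functions of L alone.\<close>

lemma prob_compact_cylinder:
  assumes B: "finite B" "\<And>K t. (K, t) \<in> B \<Longrightarrow> compact K \<and> 0 < t"
  shows "prob (X -` compact_cylinder B \<inter> space M) = exp (- L (max_over (\<lambda>p x. 1 / snd p * indicator (fst p) x) B))"
proof -
  define f where "f = max_over (\<lambda>p x. 1 / snd p * indicator (fst p) x :: real) B"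
  have B': "compact (fst p)" "0 < snd p" if "p \<in> B" for p using B(2)[of "fst p" "snd p"] that by auto
  have f: "f \<in> USC" unfolding f_def using B B' by (intro USC_max_over USC_indicator) (auto simp: less_imp_le)
  have "\<omega> \<in> X -` compact_cylinder B \<longleftrightarrow> extremal_integral (X \<omega>) f \<le> 1" if "\<omega> \<in> space M" for \<omega>
  proof -
    have sm: "sup_measure (X \<omega>)" by (rule sup_measure_tail_dependence[OF that])
    have "extremal_integral (X \<omega>) f = (SUP p\<in>B. ennreal (1 / snd p) * X \<omega> (fst p))"
      unfolding f_def using B B' by (intro extremal_integral_max_over[OF lc sm]) (auto simp: less_imp_le)
    moreover have "ennreal (1 / t) * y \<le> 1 \<longleftrightarrow> y \<le> ennreal t" if "0 < t" for t y
      using ennreal_mult_le_1_iff[of "1 / t" y] that by simp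
    ultimately show ?thesis
      using sm B' by (auto simp: compact_cylinder_def sup_measures_def SUP_le_iff case_prod_beta)
  qed
  then have "X -` compact_cylinder B \<inter> space M = {\<omega>\<in>space M. extremal_integral (X \<omega>) f \<le> 1}" by auto
  then show ?thesis using prob_extremal_le_one[OF f] by (simp add: f_def)
qed

end

section \<open>Uniqueness of the law\<close>

lemma tail_dependence_law_unique:
  fixes X1 :: "'m1 \<Rightarrow> 'a::{t2_space,second_countable_topology} set \<Rightarrow> ennreal" and X2 :: "'m2 \<Rightarrow> 'a set \<Rightarrow> ennreal"
  assumes lc: "locally_compact_space (euclidean :: 'a topology)"
    and tdf: "tail_dependence_functional M1 X1 L" "tail_dependence_functional M2 X2 L"
  shows "distr M1 (borel_of_top sup_vague_topology) X1 = distr M2 (borel_of_top sup_vague_topology) X2"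
    (is "?D1 = ?D2")
proof -
  note meas = measurable_tail_dependence[OF lc tdf(1)] measurable_tail_dependence[OF lc tdf(2)]
  interpret M1: prob_space M1 by (rule prob_space_tail_dependence[OF lc tdf(1)])
  interpret M2: prob_space M2 by (rule prob_space_tail_dependence[OF lc tdf(2)])
  have UNIV: "compact_cylinder {} = (sup_measures :: ('a set \<Rightarrow> ennreal) set)" by (simp add: compact_cylinder_def)
  show ?thesis
  \<comment> \<open>The cylinder without bounds is the whole space, so a constant sequence serves as
    the exhaustion by sets of finite measure. The sample spaces enter only through their image
    measures and may have different types.\<close>
  proof (rule measure_eqI_generator_eq[OF Int_stable_compact_cylinders compact_cylinders_subset])
    fix S :: "('a set \<Rightarrow> ennreal) set" assume S: "S \<in> compact_cylinders"
    then obtain B where B: "S = compact_cylinder B" "finite B" "\<forall>(K, t)\<in>B. compact K \<and> 0 < t"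
      by (auto simp: compact_cylinders_def)
    have B': "compact K \<and> 0 < t" if "(K, t) \<in> B" for K t using B(3) that by auto
    have "S \<in> sets (borel_of_top sup_vague_topology)"
      using S unfolding sets_borel_sup_vague[OF lc] by (rule sigma_sets.Basic)
    then show "emeasure ?D1 S = emeasure ?D2 S"
      using prob_compact_cylinder[OF lc tdf(1) B(2) B'] prob_compact_cylinder[OF lc tdf(2) B(2) B'] B(1)
      by (simp add: emeasure_distr meas M1.emeasure_eq_measure M2.emeasure_eq_measure)
  next
    show "sets ?D1 = sigma_sets sup_measures compact_cylinders"
      "sets ?D2 = sigma_sets sup_measures compact_cylinders"
      by (simp_all add: sets_borel_sup_vague[OF lc])
    show "range (\<lambda>_ :: nat. compact_cylinder {}) \<subseteq> (compact_cylinders :: ('a set \<Rightarrow> ennreal) set set)"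
      by (auto simp: compact_cylinders_def)
    show "(\<Union>_ :: nat. compact_cylinder {}) = (sup_measures :: ('a set \<Rightarrow> ennreal) set)" by (simp add: UNIV)
    show "emeasure ?D1 (compact_cylinder {}) \<noteq> \<infinity>"
      using finite_measure.emeasure_finite[OF finite_measure.finite_measure_distr[OF M1.finite_measure_axioms meas(1)]] by simp
  qed
qed

theorem mainTheorem2:
  fixes L :: "('a::{t2_space,second_countable_topology} \<Rightarrow> real) \<Rightarrow> real"
  assumes E: "locally_compact_space (euclidean :: 'a topology)"
    and nonneg: "\<forall>f\<in>USC. 0 \<le> L f"
  shows "(\<forall>(M :: 'm measure) X. tail_dependence_functional M X L \<longrightarrow>
            homogeneous_functional L \<and> max_completely_alternating L \<and> usc_functional L)
     \<and> (homogeneous_functional L \<and> max_completely_alternating L \<and> usc_functional L \<longrightarrow>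
          (\<exists>(M :: ('a set \<Rightarrow> ennreal) measure) X. tail_dependence_functional M X L))
     \<and> (\<forall>(M1 :: 'm1 measure) X1 (M2 :: 'm2 measure) X2.
          tail_dependence_functional M1 X1 L \<and> tail_dependence_functional M2 X2 L \<longrightarrow>
          distr M1 (borel_of_top sup_vague_topology) X1 = distr M2 (borel_of_top sup_vague_topology) X2)"
proof (intro conjI allI impI)
  fix M :: "'m measure" and X assume tdf: "tail_dependence_functional M X L"
  show "homogeneous_functional L" "max_completely_alternating L" "usc_functional L"
    using tail_dependence_homogeneous[OF E tdf] tail_dependence_max_completely_alternating[OF E tdf]
      tail_dependence_usc[OF E tdf] by simp_all
next
  assume "homogeneous_functional L \<and> max_completely_alternating L \<and> usc_functional L"
  then show "\<exists>(M :: ('a set \<Rightarrow> ennreal) measure) X. tail_dependence_functional M X L"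
    using nonneg by (intro ex_tail_dependence_functional[OF E]) auto
next
  fix M1 :: "'m1 measure" and X1 and M2 :: "'m2 measure" and X2
  assume "tail_dependence_functional M1 X1 L \<and> tail_dependence_functional M2 X2 L"
  then show "distr M1 (borel_of_top sup_vague_topology) X1 = distr M2 (borel_of_top sup_vague_topology) X2"
    using tail_dependence_law_unique[OF E] by blast
qed

end
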